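(* Let $k$ be a positive integer. Suppose $G$ is an oriented graph whose order $n$ is divisible by $k$ and such that $$\delta(G) \geq \left(1 - \frac{1}{\overrightarrow{TR}(k)}\right) n.$$ Then $G$ contains a perfect $T_k$-packing.
   Context: An oriented graph is a digraph with no loops and at most one directed edge between any pair of distinct vertices. The minimum degree $\delta(G)$ of an oriented graph $G$ is the minimum, over all vertices, of the number of edges (in either direction) incident to the vertex. $T_k$ denotes the transitive tournament on $k$ vertices. A perfect $T_k$-packing in an oriented graph $G$ is a collection of vertex-disjoint copies of $T_k$ in $G$ which covers all the vertices of $G$. The oriented tiling Ramsey number $\overrightarrow{TR}(k)$ is the smallest positive integer $m$ divisible by $k$ such that any orientation of the complete graph $K_m$ contains a perfect $T_k$-packing; it is a known result (due to Erdős) that such an integer exists for every $k$. *)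

theory Defs
  imports
    Complex_Main
    "Graph_Theory.Pair_Digraph"
    "Graph_Theory.Digraph_Component"
    "Graph_Theory.Digraph_Isomorphism"
begin

text \<open>
  In the locale \<^locale>\<open>pair_digraph\<close> digraphs are finite and loop-free, and their arcs are
  ordered pairs of vertices.
\<close>

locale oriented_graph = pair_digraph +
  assumes no_opposite_arcs: "(u, v) \<in> parcs G \<Longrightarrow> (v, u) \<notin> parcs G"

locale tournament = oriented_graph +
  assumes complete:
    "\<lbrakk>u \<in> pverts G; v \<in> pverts G; u \<noteq> v\<rbrakk> \<Longrightarrow> (u, v) \<in> parcs G \<or> (v, u) \<in> parcs G"

text \<open>
  There being no loops, no arc is counted twice in the sum of the two degrees.  The value for the
  graph without vertices is unspecified.
\<close>

definition min_degree :: "'a pair_pre_digraph \<Rightarrow> nat" where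
  "min_degree G =
     Min ((\<lambda>v. in_degree (with_proj G) v + out_degree (with_proj G) v) ` pverts G)"

definition transitive_tournament :: "nat \<Rightarrow> nat pair_pre_digraph" where
  "transitive_tournament k = \<lparr>pverts = {..<k}, parcs = {(i, j). i < j \<and> j < k}\<rparr>"

text \<open>A copy is a subgraph that need not be induced.\<close>

definition copy_in :: "'b pair_pre_digraph \<Rightarrow> 'a pair_pre_digraph \<Rightarrow> 'a pair_pre_digraph \<Rightarrow> bool" where
  "copy_in F H G \<longleftrightarrow>
     subgraph (with_proj H) (with_proj G) \<and> digraph_iso (with_proj F) (with_proj H)"

definition perfect_packing ::
    "'b pair_pre_digraph \<Rightarrow> 'a pair_pre_digraph \<Rightarrow> 'a pair_pre_digraph set \<Rightarrow> bool" where
  "perfect_packing F G P \<longleftrightarrow>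
     (\<forall>H\<in>P. copy_in F H G) \<and>
     (\<forall>H\<in>P. \<forall>H'\<in>P. H \<noteq> H' \<longrightarrow> pverts H \<inter> pverts H' = {}) \<and>
     (\<Union>H\<in>P. pverts H) = pverts G"

text \<open>
  Tournaments of order \<open>m\<close> are the orientations of the complete graph on \<open>m\<close> vertices; up to
  isomorphism it suffices to consider those whose vertices are natural numbers.
\<close>

definition oriented_tiling_Ramsey :: "nat \<Rightarrow> nat" where
  "oriented_tiling_Ramsey k =
     (LEAST m. 0 < m \<and> k dvd m \<and>
        (\<forall>T :: nat pair_pre_digraph. tournament T \<and> card (pverts T) = m \<longrightarrow>
           (\<exists>P. perfect_packing (transitive_tournament k) T P)))"

end

theory Submission
  imports Defs
begin

text \<open>
  Write \<open>m\<close> for the tiling Ramsey number and \<open>n = q * m + r\<close> with \<open>r < m\<close>.  The degree condition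
  says that in the complement every vertex has degree less than \<open>q\<close>; this survives the removal of
  vertices.  As long as more than \<open>q * m\<close> vertices are left, the Hajnal-Szemeredi theorem applied
  to \<open>q * m\<close> of them gives a clique of order \<open>m\<close>, hence a transitive tournament on \<open>k\<close> vertices
  that can be removed.  Since \<open>k\<close> divides \<open>r\<close>, exactly \<open>q * m\<close> vertices remain in the end;
  these are partitioned by the Hajnal-Szemeredi theorem into \<open>q\<close> tournaments of order \<open>m\<close>, each
  of which has a perfect packing.

  The Hajnal-Szemeredi theorem is proved by the argument of Kierstead and Kostochka.  That \<open>m\<close> is
  well defined is seen by setting aside a long transitive tournament, packing the rest greedily,
  and absorbing the few leftover vertices into the transitive tournament.
\<close>

section \<open>Reachability in finite digraphs\<close>

text \<open>Paths stay inside \<open>D\<close>, but the empty path is allowed even at a vertex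
  outside \<open>D\<close>. So \<open>a\<close> always reaches itself, also after its own
  removal.\<close>

abbreviation reaches :: "'c rel \<Rightarrow> 'c set \<Rightarrow> 'c \<Rightarrow> 'c \<Rightarrow> bool" where
  "reaches R D x y \<equiv> (x, y) \<in> (R \<inter> D \<times> D)\<^sup>*"

lemma reaches_end_in:
  assumes "reaches R D x y" "x \<noteq> y"
  shows "y \<in> D"
  using assms by (metis IntD2 SigmaD2 rtranclE)

text \<open>Cut the path at its last visit to \<open>c\<close>: what follows never meets
  \<open>c\<close> again.\<close>

lemma reaches_leave:
  assumes "reaches R D c a" "c \<noteq> a"
  obtains d where "c \<in> D" "d \<in> D - {c}" "(c, d) \<in> R" "reaches R (D - {c}) d a"
proof -
  \<comment> \<open>The second alternative records the last departure from \<open>c\<close>; until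
    it is found, the part of the path from \<open>x\<close> on avoids \<open>c\<close>.\<close>
  have "(x \<noteq> c \<and> reaches R (D - {c}) x a) \<or>
      (\<exists>d. c \<in> D \<and> d \<in> D - {c} \<and> (c, d) \<in> R \<and> reaches R (D - {c}) d a)"
    if "reaches R D x a" for x
    using that
  proof (induction rule: converse_rtrancl_induct)
    case base
    then show ?case using assms(2) by blast
  next
    case (step x y)
    show ?case
    proof (cases "\<exists>d. c \<in> D \<and> d \<in> D - {c} \<and> (c, d) \<in> R \<and> reaches R (D - {c}) d a")
      case False
      then have y: "y \<noteq> c" "reaches R (D - {c}) y a" using step.IH by blast+
      show ?thesis
      proof (cases "x = c")
        case True
        then show ?thesis using y step.hyps by blast
      next
        case False
        then have "(x, y) \<in> R \<inter> (D - {c}) \<times> (D - {c})" using y step.hyps by blast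
        then show ?thesis using y False by (meson converse_rtrancl_into_rtrancl)
      qed
    qed blast
  qed
  then show ?thesis using assms that by blast
qed

text \<open>The family \<open>T\<close> consists of the vertices that \<open>u\<close> separates from \<open>a\<close>; choosing it
  of minimal cardinality makes each of its members inessential for reaching \<open>a\<close>.\<close>

lemma terminal_family:
  assumes "finite S" "a \<in> S" "S \<noteq> {a}" and reach: "\<And>c. c \<in> S \<Longrightarrow> reaches R S c a"
  obtains u T where "u \<in> S" "T \<subseteq> S - {u}" "T \<noteq> {}" "a \<notin> T"
    "\<And>w x. \<lbrakk>w \<in> T; x \<in> S - {w}\<rbrakk> \<Longrightarrow> reaches R (S - {w}) x a"
    "\<And>w x. \<lbrakk>w \<in> T; x \<in> S - {u} - T\<rbrakk> \<Longrightarrow> (w, x) \<notin> R"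
proof -
  define T where "T u = {w \<in> S - {u}. \<not> reaches R (S - {u}) w a}" for u
  \<comment> \<open>Removing \<open>a\<close> separates everything else from it, so there is a
    nonempty \<open>T u\<close> and hence one of least cardinality.\<close>
  have "T a = S - {a}"
    using reaches_end_in[of _ a R "S - {a}"] by (auto simp: T_def)
  then have "a \<in> S \<and> T a \<noteq> {}" using assms(2,3) by auto
  then obtain u where u: "u \<in> S" "T u \<noteq> {}"
    and min: "\<And>w. w \<in> S \<Longrightarrow> T w \<noteq> {} \<Longrightarrow> card (T u) \<le> card (T w)"
    using ex_has_least_nat[of "\<lambda>u. u \<in> S \<and> T u \<noteq> {}" a "\<lambda>u. card (T u)"] by blast
  \<comment> \<open>A path to \<open>a\<close> that avoids \<open>u\<close> also avoids
    \<open>w\<close>, since \<open>w\<close> has no such path. So \<open>T w\<close> is a proper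
    subset of \<open>T u\<close>, and minimality makes it empty.\<close>
  have terminal: "T w = {}" if w: "w \<in> T u" for w
  proof (rule ccontr)
    assume ne: "T w \<noteq> {}"
    have wS: "w \<in> S" "w \<noteq> u" and wn: "\<not> reaches R (S - {u}) w a" using w by (auto simp: T_def)
    have avoid: "reaches R (S - {w}) c a" if "reaches R (S - {u}) c a" for c
      using that
    proof (induction rule: converse_rtrancl_induct)
      case (step c d)
      then have "reaches R (S - {u}) c a" by (meson converse_rtrancl_into_rtrancl)
      then have "c \<noteq> w" "d \<noteq> w" using wn step.hyps by auto
      then have "(c, d) \<in> R \<inter> (S - {w}) \<times> (S - {w})" using step.hyps by blast
      then show ?case using step.IH by (meson converse_rtrancl_into_rtrancl)
    qed simp
    \<comment> \<open>After its last visit to \<open>u\<close>, a path from \<open>u\<close> to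
      \<open>a\<close> runs inside \<open>S - {u}\<close> and so misses \<open>w\<close>.\<close>
    have "u \<notin> T w"
    proof (cases "u = a")
      case False
      obtain d where d: "u \<in> S" "d \<in> S - {u}" "(u, d) \<in> R" "reaches R (S - {u}) d a"
        using reaches_leave[OF reach[OF u(1)] False] by blast
      then have "d \<noteq> w" using wn by auto
      then have "(u, d) \<in> R \<inter> (S - {w}) \<times> (S - {w})" using d wS by blast
      then show ?thesis using avoid[OF d(4)] unfolding T_def by (auto intro: converse_rtrancl_into_rtrancl)
    qed (simp add: T_def)
    moreover have "w \<notin> T w" by (simp add: T_def)
    ultimately have "T w \<subset> T u" using avoid w unfolding T_def by blast
    moreover have "finite (T u)" using assms(1) by (simp add: T_def)
    ultimately have "card (T w) < card (T u)" by (rule psubset_card_mono[rotated])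
    then show False using min[OF wS(1) ne] by simp
  qed
  have "a \<notin> T u" by (simp add: T_def)
  moreover have "T u \<subseteq> S - {u}" by (auto simp: T_def)
  moreover have "reaches R (S - {w}) x a" if "w \<in> T u" "x \<in> S - {w}" for w x
    using terminal[OF that(1)] that(2) by (auto simp: T_def)
  moreover have "(w, x) \<notin> R" if "w \<in> T u" "x \<in> S - {u} - T u" for w x
  proof
    assume "(w, x) \<in> R"
    then have "(w, x) \<in> R \<inter> (S - {u}) \<times> (S - {u})" using that by (auto simp: T_def)
    moreover have "reaches R (S - {u}) x a" using that by (auto simp: T_def)
    ultimately have "reaches R (S - {u}) w a" by (meson converse_rtrancl_into_rtrancl)
    then show False using that(1) by (simp add: T_def)
  qed
  ultimately show ?thesis using that u by metis
qed

section \<open>Equitable colourings\<close>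

definition nbrs :: "('a \<Rightarrow> 'a \<Rightarrow> bool) \<Rightarrow> 'a set \<Rightarrow> 'a \<Rightarrow> 'a set" where
  "nbrs E S x = {y \<in> S. E x y}"

definition colour_class :: "'a set \<Rightarrow> ('a \<Rightarrow> 'c) \<Rightarrow> 'c \<Rightarrow> 'a set" where
  "colour_class V f c = {x \<in> V. f x = c}"

definition proper :: "'a set \<Rightarrow> ('a \<Rightarrow> 'a \<Rightarrow> bool) \<Rightarrow> 'c set \<Rightarrow> ('a \<Rightarrow> 'c) \<Rightarrow> bool" where
  "proper V E C f \<longleftrightarrow> f ` V \<subseteq> C \<and> (\<forall>x\<in>V. \<forall>y\<in>V. E x y \<longrightarrow> f x \<noteq> f y)"

definition equitable :: "'a set \<Rightarrow> ('a \<Rightarrow> 'a \<Rightarrow> bool) \<Rightarrow> 'c set \<Rightarrow> nat \<Rightarrow> ('a \<Rightarrow> 'c) \<Rightarrow> bool" where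
  "equitable V E C s f \<longleftrightarrow> proper V E C f \<and> (\<forall>c\<in>C. card (colour_class V f c) = s)"

text \<open>The auxiliary digraph of Kierstead and Kostochka on the colours: along an arc some
  vertex can be recoloured with the colouring staying proper.\<close>

definition move_rel :: "'a set \<Rightarrow> ('a \<Rightarrow> 'a \<Rightarrow> bool) \<Rightarrow> ('a \<Rightarrow> 'c) \<Rightarrow> 'c rel" where
  "move_rel V E f = {(c, d). \<exists>y\<in>colour_class V f c. nbrs E (colour_class V f d) y = {}}"

lemma finite_nbrs [simp]: "finite S \<Longrightarrow> finite (nbrs E S x)"
  by (simp add: nbrs_def)

lemma finite_colour_class [simp]: "finite V \<Longrightarrow> finite (colour_class V f c)"
  by (simp add: colour_class_def)

lemma equitable_union:
  assumes "equitable V1 E C1 s f1" "equitable V2 E C2 s f2" "V1 \<inter> V2 = {}" "C1 \<inter> C2 = {}"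
  shows "equitable (V1 \<union> V2) E (C1 \<union> C2) s (\<lambda>x. if x \<in> V1 then f1 x else f2 x)" (is "equitable ?V E ?C s ?f")
proof -
  have 1: "f1 ` V1 \<subseteq> C1" "f2 ` V2 \<subseteq> C2" using assms unfolding equitable_def proper_def by auto
  have "colour_class ?V ?f c = colour_class V1 f1 c" if "c \<in> C1" for c
    using 1 assms(3,4) that by (fastforce simp: colour_class_def)
  moreover have "colour_class ?V ?f c = colour_class V2 f2 c" if "c \<in> C2" for c
    using 1 assms(3,4) that by (fastforce simp: colour_class_def)
  moreover have "?f x \<noteq> ?f y" if "x \<in> ?V" "y \<in> ?V" "E x y" for x y
  proof (cases "x \<in> V1 \<longleftrightarrow> y \<in> V1")
    case True
    then show ?thesis using that assms(1,2) unfolding equitable_def proper_def by auto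
  next
    case False
    then show ?thesis using that 1 assms(4) by auto
  qed
  then have "proper ?V E ?C ?f" using 1 unfolding proper_def by auto
  ultimately show ?thesis using assms(1,2) unfolding equitable_def by auto
qed

lemma colour_class_upd:
  "colour_class V (f(y := d)) c =
    (if c = d then insert y (colour_class V f c) else colour_class V f c - {y})" if "y \<in> V"
  using that by (auto simp: colour_class_def)

lemma proper_upd:
  assumes "proper V E C f" "symp E" "irreflp E" "d \<in> C" "nbrs E (colour_class V f d) y = {}"
  shows "proper V E C (f(y := d))"
  using assms unfolding proper_def nbrs_def colour_class_def
  by (auto dest: sympD irreflpD)

text \<open>Recolour one vertex along each arc of a path. The changes are confined to
  \<open>D\<close>, and class \<open>c\<close> only loses vertices, so whatever could move into it
  still can. The \<open>of_bool\<close> terms let the size equation cover \<open>c = a\<close> as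
  well.\<close>

lemma shift_along_path:
  assumes "finite V" "symp E" "irreflp E" "proper V E C f" "finite D" "D \<subseteq> C"
    and "reaches (move_rel V E f) D c a"
  obtains g where "proper V E C g" "\<And>x. f x \<notin> D \<Longrightarrow> g x = f x" "\<And>x. f x \<in> D \<Longrightarrow> g x \<in> D"
    "colour_class V g c \<subseteq> colour_class V f c"
    "\<And>e. card (colour_class V g e) + of_bool (e = c) = card (colour_class V f e) + of_bool (e = a)"
proof -
  have "\<exists>g. proper V E C g \<and> (\<forall>x. f x \<notin> D \<longrightarrow> g x = f x) \<and> (\<forall>x. f x \<in> D \<longrightarrow> g x \<in> D)
    \<and> colour_class V g c \<subseteq> colour_class V f c
    \<and> (\<forall>e. card (colour_class V g e) + of_bool (e = c) = card (colour_class V f e) + of_bool (e = a))"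
    using assms(5-7)
  proof (induction D arbitrary: c rule: finite_psubset_induct)
    case (psubset D)
    show ?case
    proof (cases "c = a")
      case True
      then show ?thesis using assms(4) by (intro exI[of _ f]) auto
    next
      case False
      then obtain d where d: "c \<in> D" "d \<in> D - {c}" "(c, d) \<in> move_rel V E f"
        "reaches (move_rel V E f) (D - {c}) d a"
        using reaches_leave[OF psubset.prems(2) False] by blast
      \<comment> \<open>The rest of the path is shifted first, inside \<open>D - {c}\<close>. This
        leaves class \<open>c\<close> untouched and only shrinks class \<open>d\<close>, so
        \<open>y\<close> can still move there.\<close>
      have "D - {c} \<subset> D" "D - {c} \<subseteq> C" using d psubset.prems by auto
      from psubset.IH[OF this d(4)] obtain g where g: "proper V E C g"
        "\<And>x. f x \<notin> D - {c} \<Longrightarrow> g x = f x" "\<And>x. f x \<in> D - {c} \<Longrightarrow> g x \<in> D - {c}"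
        "colour_class V g d \<subseteq> colour_class V f d"
        "\<And>e. card (colour_class V g e) + of_bool (e = d) = card (colour_class V f e) + of_bool (e = a)"
        by blast
      obtain y where y: "y \<in> V" "f y = c" "nbrs E (colour_class V f d) y = {}"
        using d(3) by (auto simp: move_rel_def colour_class_def)
      have gy: "g y = c" using g(2) y by auto
      have ny: "nbrs E (colour_class V g d) y = {}" using y(3) g(4) by (auto simp: nbrs_def)
      let ?h = "g(y := d)"
      have cc: "colour_class V g c = colour_class V f c"
        using g(2,3) by (auto simp: colour_class_def) (metis DiffD2 DiffE insertI1)+
      have "proper V E C ?h"
        using proper_upd[OF g(1) assms(2,3) _ ny] d psubset.prems by auto
      moreover have "\<forall>x. f x \<notin> D \<longrightarrow> ?h x = f x" using g(2) y d(1) by auto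
      moreover have "\<forall>x. f x \<in> D \<longrightarrow> ?h x \<in> D" using g(2,3) y d by (metis DiffD1 fun_upd_apply)
      moreover have "colour_class V ?h c \<subseteq> colour_class V f c"
        using cc d(2) by (auto simp: colour_class_upd[OF y(1)])
      moreover have "card (colour_class V ?h e) + of_bool (e = c) = card (colour_class V f e) + of_bool (e = a)" for e
      proof -
        have yc: "y \<in> colour_class V g e \<longleftrightarrow> e = c" using y gy by (auto simp: colour_class_def)
        consider "e = d" | "e = c" | "e \<noteq> d" "e \<noteq> c" by blast
        then show ?thesis
        proof cases
          case 1
          then show ?thesis using g(5)[of e] yc d(2) assms(1) y
            by (simp add: colour_class_upd[OF y(1)])
        next
          case 2
          then have "card (colour_class V g e) = Suc (card (colour_class V g e - {y}))"
            using yc assms(1) by (metis card_Suc_Diff1 finite_colour_class)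
          then show ?thesis using g(5)[of e] 2 d(2) y by (auto simp: colour_class_upd[OF y(1)])
        next
          case 3
          then show ?thesis using g(5)[of e] yc by (simp add: colour_class_upd[OF y(1)])
        qed
      qed
      ultimately show ?thesis by blast
    qed
  qed
  then show ?thesis using that by blast
qed

section \<open>Counting edges and colour classes\<close>

lemma double_count:
  assumes "finite X" "finite Y" "symp E"
  shows "(\<Sum>x\<in>X. card (nbrs E Y x)) = (\<Sum>y\<in>Y. card (nbrs E X y))"
proof -
  have "(\<Sum>x\<in>X. card (nbrs E Y x)) = (\<Sum>x\<in>X. \<Sum>y | y \<in> Y \<and> E x y. 1)"
    by (simp add: nbrs_def)
  also have "\<dots> = (\<Sum>y\<in>Y. \<Sum>x | x \<in> X \<and> E x y. 1)"
    using assms(1,2) by (rule sum.swap_restrict)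
  also have "\<dots> = (\<Sum>y\<in>Y. card (nbrs E X y))"
    using assms(3) by (auto simp: nbrs_def intro!: sum.cong arg_cong[of _ _ card] dest: sympD)
  finally show ?thesis .
qed

lemma card_fibres:
  assumes "finite V" "finite D"
  shows "card {x \<in> V. f x \<in> D} = (\<Sum>c\<in>D. card (colour_class V f c))"
proof -
  have "{x \<in> V. f x \<in> D} = (\<Union>c\<in>D. colour_class V f c)" by (auto simp: colour_class_def)
  then show ?thesis
    using assms by (simp add: card_UN_disjoint colour_class_def disjoint_iff)
qed

lemma card_nbrs_fibres:
  assumes "finite V" "finite D"
  shows "card (nbrs E {x \<in> V. f x \<in> D} y) = (\<Sum>c\<in>D. card (nbrs E (colour_class V f c) y))"
proof -
  have "nbrs E {x \<in> V. f x \<in> D} y = {x \<in> nbrs E V y. f x \<in> D}" by (auto simp: nbrs_def)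
  moreover have "colour_class (nbrs E V y) f c = nbrs E (colour_class V f c) y" for c
    by (auto simp: nbrs_def colour_class_def)
  ultimately show ?thesis using card_fibres[of "nbrs E V y" D f] assms by simp
qed

section \<open>Nearly equitable colourings and accessible classes\<close>

definition accessible :: "'a set \<Rightarrow> ('a \<Rightarrow> 'a \<Rightarrow> bool) \<Rightarrow> 'c set \<Rightarrow> ('a \<Rightarrow> 'c) \<Rightarrow> 'c \<Rightarrow> 'c set" where
  "accessible V E C f a = {c \<in> C. reaches (move_rel V E f) C c a}"

locale bounded_degree =
  fixes V :: "'a set" and E :: "'a \<Rightarrow> 'a \<Rightarrow> bool" and C :: "'c set" and s :: nat
  assumes finV: "finite V" and finC: "finite C" and sym_E: "symp E" and irrefl_E: "irreflp E"
    and deg: "x \<in> V \<Longrightarrow> card (nbrs E V x) < card C"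

text \<open>The situation after one vertex of an equitable colouring has changed its class:
  \<open>a\<close> has lost it and \<open>b\<close> has gained it. The sizes force \<open>a\<close>
  and \<open>b\<close> to differ.\<close>

locale nearly_equitable = bounded_degree +
  fixes f :: "'a \<Rightarrow> 'c" and a b :: 'c
  assumes proper_f: "proper V E C f" and aC: "a \<in> C" and bC: "b \<in> C"
    and card_a: "Suc (card (colour_class V f a)) = s"
    and card_b: "card (colour_class V f b) = Suc s"
    and card_c: "\<And>c. \<lbrakk>c \<in> C; c \<noteq> a; c \<noteq> b\<rbrakk> \<Longrightarrow> card (colour_class V f c) = s"
begin

abbreviation "cls \<equiv> colour_class V f"
abbreviation "H \<equiv> move_rel V E f"
abbreviation "Acc \<equiv> accessible V E C f a"

lemma equitable_of_accessible:
  assumes "b \<in> Acc"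
  shows "\<exists>g. equitable V E C s g"
proof -
  have "reaches H C b a" using assms by (simp add: accessible_def)
  then obtain g where g: "proper V E C g"
    "\<And>e. card (colour_class V g e) + of_bool (e = b) = card (cls e) + of_bool (e = a)"
    by (rule shift_along_path[OF finV sym_E irrefl_E proper_f finC subset_refl]) (rule that; assumption)
  have "card (colour_class V g e) = s" if "e \<in> C" for e
    using g(2)[of e] card_a card_b card_c[OF that] by (cases "e = a"; cases "e = b") auto
  then show ?thesis using g(1) by (auto simp: equitable_def)
qed

end

locale nearly_equitable_blocked = nearly_equitable +
  assumes b_blocked: "b \<notin> accessible V E C f a"
begin

definition "A = {x \<in> V. f x \<in> Acc}"
definition "B = {x \<in> V. f x \<notin> Acc}"

lemma s_pos: "0 < s"
  using card_a by auto

lemma fC: "x \<in> V \<Longrightarrow> f x \<in> C"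
  using proper_f by (auto simp: proper_def)

lemma finAcc: "finite Acc" and AccC: "Acc \<subseteq> C" and aAcc: "a \<in> Acc"
  using finC aC by (auto simp: accessible_def)

lemma finA: "finite A" and finB: "finite B"
  using finV by (auto simp: A_def B_def)

lemma AB: "A \<union> B = V" "A \<inter> B = {}"
  by (auto simp: A_def B_def)

lemma not_movable:
  assumes "x \<in> V" "(f x, c) \<notin> H"
  shows "nbrs E (cls c) x \<noteq> {}"
  using assms by (auto simp: move_rel_def colour_class_def)

text \<open>A vertex of \<open>B\<close> without a neighbour in an accessible class could move
  there, which would make its own class accessible.\<close>

lemma blocked_nbr:
  assumes "y \<in> B" "c \<in> Acc"
  shows "nbrs E (cls c) y \<noteq> {}"
proof (rule not_movable)
  show "y \<in> V" using assms(1) by (simp add: B_def)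
  show "(f y, c) \<notin> H"
  proof
    assume "(f y, c) \<in> H"
    moreover have "f y \<in> C" "c \<in> C" using assms fC AccC by (auto simp: B_def)
    moreover have "reaches H C c a" using assms(2) by (simp add: accessible_def)
    ultimately have "reaches H C (f y) a"
      by (meson IntI SigmaI converse_rtrancl_into_rtrancl)
    then show False using assms(1) \<open>f y \<in> C\<close> by (simp add: B_def accessible_def)
  qed
qed

lemma reaches_Acc:
  assumes "c \<in> Acc"
  shows "reaches H Acc c a"
proof -
  have "reaches H C c a" using assms by (simp add: accessible_def)
  then show ?thesis
  proof (induction rule: converse_rtrancl_induct)
    case (step x y)
    then have "x \<in> C" "reaches H C x a" "y \<in> C" "reaches H C y a"
      by (auto intro: converse_rtrancl_into_rtrancl)
    then have "(x, y) \<in> H \<inter> Acc \<times> Acc" using step.hyps by (auto simp: accessible_def)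
    then show ?case using step.IH by (meson converse_rtrancl_into_rtrancl)
  qed simp
qed

lemma card_nbrs_split:
  shows "card (nbrs E V x) = card (nbrs E A x) + card (nbrs E B x)"
proof -
  have "nbrs E V x = nbrs E A x \<union> nbrs E B x" "nbrs E A x \<inter> nbrs E B x = {}"
    using AB by (auto simp: nbrs_def)
  then show ?thesis using finA finB by (simp add: card_Un_disjoint)
qed

lemma card_Acc_less: "card Acc < card C"
  using b_blocked bC AccC finC by (metis psubsetI psubset_card_mono)

text \<open>The small class \<open>a\<close> is accessible and the large class \<open>b\<close> is
  not. The double counts below turn on this one surplus vertex.\<close>

lemma card_B: "card B = (card C - card Acc) * s + 1"
proof -
  have "B = {x \<in> V. f x \<in> C - Acc}" using fC by (auto simp: B_def)
  then have "card B = (\<Sum>c\<in>C - Acc. card (cls c))"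
    using card_fibres[OF finV, of "C - Acc" f] finC by simp
  also have "\<dots> = (\<Sum>c\<in>C - Acc. s + of_bool (c = b))"
    using card_b card_c aAcc by (intro sum.cong) auto
  also have "\<dots> = card (C - Acc) * s + (\<Sum>c\<in>C - Acc. of_bool (c = b))"
    by (simp add: sum.distrib)
  also have "(\<Sum>c\<in>C - Acc. of_bool (c = b)) = (\<Sum>c\<in>C - Acc. if b = c then 1 else 0 :: nat)"
    by (intro sum.cong) auto
  also have "\<dots> = 1"
    using finC b_blocked bC by simp
  finally show ?thesis using AccC finC by (simp add: card_Diff_subset finAcc)
qed

lemma card_nbrs_A_ge:
  assumes "finite D" "D \<subseteq> Acc" "\<And>c. c \<in> D \<Longrightarrow> nbrs E (cls c) x \<noteq> {}"
  shows "card D \<le> card (nbrs E A x)"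
proof -
  have "card D = (\<Sum>c\<in>D. 1)" by simp
  also have "\<dots> \<le> (\<Sum>c\<in>D. card (nbrs E (cls c) x))"
    using assms(3) finV by (intro sum_mono) (simp add: Suc_le_eq card_gt_0_iff)
  also have "\<dots> \<le> (\<Sum>c\<in>Acc. card (nbrs E (cls c) x))"
    using assms finAcc by (intro sum_mono2) auto
  also have "\<dots> = card (nbrs E A x)"
    using card_nbrs_fibres[OF finV finAcc, of E f x] by (simp add: A_def)
  finally show ?thesis .
qed

text \<open>At least one neighbour is spent on each accessible class. What remains is the degree
  bound needed to colour within \<open>B\<close> by the inaccessible colours alone.\<close>

lemma card_nbrs_B_less:
  assumes "y \<in> B"
  shows "card (nbrs E B y) < card C - card Acc"
proof -
  have "card Acc \<le> card (nbrs E A y)"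
    using blocked_nbr assms by (intro card_nbrs_A_ge finAcc) auto
  moreover have "y \<in> V" using assms by (simp add: B_def)
  ultimately show ?thesis using card_nbrs_split[of y] deg[of y] by simp
qed

text \<open>Otherwise each of the more than \<open>(card C - 1) * s\<close> vertices of
  \<open>B\<close> has a neighbour among the \<open>s - 1\<close> vertices of class
  \<open>a\<close>, and these have fewer than \<open>card C\<close> neighbours each.\<close>

lemma Acc_neq: "Acc \<noteq> {a}"
proof
  assume Acc: "Acc = {a}"
  have "card B = (\<Sum>y\<in>B. 1)" by simp
  also have "\<dots> \<le> (\<Sum>y\<in>B. card (nbrs E (cls a) y))"
    using blocked_nbr[OF _ aAcc] finV by (intro sum_mono) (simp add: Suc_le_eq card_gt_0_iff)
  also have "\<dots> = (\<Sum>x\<in>cls a. card (nbrs E B x))"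
    using finV finB sym_E by (intro double_count) auto
  also have "\<dots> \<le> (\<Sum>x\<in>cls a. card C - 1)"
  proof (intro sum_mono)
    fix x assume "x \<in> cls a"
    then have "card (nbrs E V x) < card C" using deg by (auto simp: colour_class_def)
    then show "card (nbrs E B x) \<le> card C - 1" using card_nbrs_split[of x] by linarith
  qed
  also have "\<dots> \<le> (card C - 1) * s" using card_a by simp
  finally show False using card_B Acc by simp
qed

end

section \<open>Solo edges and the exchange argument of Kierstead and Kostochka\<close>

locale kierstead_kostochka = nearly_equitable_blocked +
  fixes u and T
  assumes uT: "u \<in> accessible V E C f a" "T \<subseteq> accessible V E C f a - {u}" "T \<noteq> {}" "a \<notin> T"
    and terminal: "\<And>w x. \<lbrakk>w \<in> T; x \<in> accessible V E C f a - {w}\<rbrakk>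
      \<Longrightarrow> reaches (move_rel V E f) (accessible V E C f a - {w}) x a"
    and no_exit: "\<And>w x. \<lbrakk>w \<in> T; x \<in> accessible V E C f a - {u} - T\<rbrakk> \<Longrightarrow> (w, x) \<notin> move_rel V E f"
    and equitable_B: "\<And>y. y \<in> V \<Longrightarrow> f y \<notin> accessible V E C f a \<Longrightarrow>
      \<exists>g. equitable ({x \<in> V. f x \<notin> accessible V E C f a} - {y}) E (C - accessible V E C f a) s g"
begin

text \<open>The solo edges of Kierstead and Kostochka: once \<open>z\<close> leaves its class,
  \<open>y\<close> can take its place there.\<close>

definition "solo z y \<longleftrightarrow> z \<in> V \<and> f z \<in> T \<and> y \<in> B \<and> nbrs E (cls (f z)) y = {z}"

definition "q = card C - card Acc"

lemma TAcc: "T \<subseteq> Acc" and finT: "finite T"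
  using uT finAcc by (auto intro: finite_subset)

lemma card_T_class: "w \<in> T \<Longrightarrow> card (cls w) = s"
  using card_c uT b_blocked AccC by blast

lemma soloD:
  assumes "solo z y"
  shows "z \<in> A" "y \<in> B" "E y z" "E z y" "f z \<in> T" "z \<notin> B" "y \<noteq> z"
proof -
  have "z \<in> nbrs E (cls (f z)) y" using assms by (simp add: solo_def)
  then show "E y z" "E z y" using sym_E by (auto simp: nbrs_def dest: sympD)
  show "z \<in> A" "y \<in> B" "f z \<in> T" "z \<notin> B" "y \<noteq> z" using assms TAcc by (auto simp: solo_def A_def B_def)
qed

text \<open>By \<open>no_exit\<close> the vertex \<open>x\<close> has a neighbour in each of the
  \<open>card Acc - 1 - card T\<close> accessible classes that are neither \<open>u\<close> nor in
  \<open>T\<close>.\<close>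

lemma card_nbrs_B_T:
  assumes "x \<in> V" "f x \<in> T"
  shows "card (nbrs E B x) \<le> card T + q"
proof -
  have "card (Acc - {u} - T) \<le> card (nbrs E A x)"
    using assms no_exit by (intro card_nbrs_A_ge not_movable) (auto simp: finAcc)
  moreover have "card (Acc - {u} - T) = card Acc - 1 - card T"
    using uT finT finAcc by (simp add: card_Diff_subset)
  ultimately show ?thesis using card_nbrs_split[of x] deg[OF assms(1)] by (simp add: q_def)
qed

text \<open>In \<open>A\<close>, the vertex \<open>y\<close> has at least one neighbour in each
  accessible class and at least two in each class of \<open>T\<close> that contains no solo
  neighbour of it. Compare this with the degree bound.\<close>

lemma card_solo_ge:
  assumes y: "y \<in> B"
  shows "card T + card (nbrs E B y) + 1 \<le> q + card {z \<in> V. solo z y}"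
proof -
  define D1 where "D1 = {c \<in> T. card (nbrs E (cls c) y) = 1}"
  have D1: "D1 \<subseteq> T" "finite D1" using finT by (auto simp: D1_def)
  have "D1 \<subseteq> f ` {z \<in> V. solo z y}"
  proof
    fix c assume c: "c \<in> D1"
    then obtain z where z: "nbrs E (cls c) y = {z}" by (auto simp: D1_def card_1_singleton_iff)
    then have "z \<in> V" "f z = c" by (auto simp: nbrs_def colour_class_def)
    then show "c \<in> f ` {z \<in> V. solo z y}" using z y c D1 by (auto simp: solo_def)
  qed
  then have 1: "card D1 \<le> card {z \<in> V. solo z y}" using finV by (intro surj_card_le) auto
  have "card Acc + card (T - D1) = (\<Sum>c\<in>Acc. 1) + (\<Sum>c\<in>T - D1. 1)" by simp
  also have "(\<Sum>c\<in>T - D1. 1) = (\<Sum>c\<in>Acc. if c \<in> T - D1 then 1 else 0 :: nat)"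
    using finAcc TAcc by (subst sum.inter_restrict[symmetric]) (auto intro!: arg_cong[of _ _ card])
  also have "(\<Sum>c\<in>Acc. 1) + \<dots> = (\<Sum>c\<in>Acc. 1 + (if c \<in> T - D1 then 1 else 0))"
    by (simp only: sum.distrib)
  also have "\<dots> \<le> (\<Sum>c\<in>Acc. card (nbrs E (cls c) y))"
  proof (rule sum_mono)
    fix c assume "c \<in> Acc"
    then have "card (nbrs E (cls c) y) \<noteq> 0" using blocked_nbr[OF y] finV by auto
    then show "1 + (if c \<in> T - D1 then 1 else 0) \<le> card (nbrs E (cls c) y)"
      by (auto simp: D1_def)
  qed
  also have "\<dots> = card (nbrs E A y)"
    using card_nbrs_fibres[OF finV finAcc, of E f y] by (simp add: A_def)
  finally have "card Acc + card (T - D1) \<le> card (nbrs E A y)" .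
  moreover have "card (T - D1) = card T - card D1" "card D1 \<le> card T"
    using D1 finT by (auto simp: card_Diff_subset card_mono)
  ultimately show ?thesis using 1 card_nbrs_split[of y] deg[of y] y card_Acc_less
    by (simp add: q_def B_def)
qed

text \<open>Move \<open>z\<close> to \<open>X\<close>, put \<open>y\<close> in its place, and pass
  the surplus of \<open>X\<close> on to \<open>a\<close>. Then \<open>A\<close> together with
  \<open>y\<close> is coloured equitably by the accessible colours, and \<open>equitable_B\<close>
  takes care of the rest.\<close>

lemma equitable_of_movable_solo:
  assumes zy: "solo z y" and X: "X \<in> Acc - {f z}" "nbrs E (cls X) z = {}"
  shows "\<exists>g. equitable V E C s g"
proof -
  define W where "W = f z"
  have W: "W \<in> T" "W \<noteq> X" "W \<noteq> a" using soloD[OF zy] X uT by (auto simp: W_def)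
  have zV: "z \<in> V" and yV: "y \<in> V" "f y \<notin> Acc" and ny: "nbrs E (cls W) y = {z}"
    using zy by (auto simp: solo_def B_def W_def)
  \<comment> \<open>The shift from \<open>X\<close> to \<open>a\<close> can avoid \<open>W\<close>,
    so \<open>z\<close> remains the only neighbour of \<open>y\<close> there, while class
    \<open>X\<close> keeps admitting \<open>z\<close>.\<close>
  have "reaches H (Acc - {W}) X a" using terminal X W by (auto simp: W_def)
  then obtain g where g: "proper V E C g" "\<And>x. f x \<notin> Acc - {W} \<Longrightarrow> g x = f x"
    "\<And>x. f x \<in> Acc - {W} \<Longrightarrow> g x \<in> Acc - {W}" "colour_class V g X \<subseteq> cls X"
    "\<And>e. card (colour_class V g e) + of_bool (e = X) = card (cls e) + of_bool (e = a)"
    using shift_along_path[OF finV sym_E irrefl_E proper_f, of "Acc - {W}"] finAcc AccC by blast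
  have gz: "g z = W" and gy: "g y = f y" using g(2) yV by (auto simp: W_def)
  have clsW: "colour_class V g W = cls W"
    using g(2,3) by (auto simp: colour_class_def) (metis DiffE insertI1)+
  define h where "h = g(z := X, y := W)"
  have zy_ne: "y \<noteq> z" using soloD[OF zy] by simp
  have p1: "proper V E C (g(z := X))"
    using X g(4) AccC by (intro proper_upd[OF g(1) sym_E irrefl_E]) (auto simp: nbrs_def)
  have "nbrs E (colour_class V (g(z := X)) W) y = {}"
    using ny clsW W zV by (auto simp: colour_class_upd nbrs_def)
  then have p2: "proper V E C h"
    unfolding h_def using W TAcc AccC by (intro proper_upd[OF p1 sym_E irrefl_E]) auto
  \<comment> \<open>Accessible colours are now used exactly on \<open>A\<close> and
    \<open>y\<close>, so the colouring of \<open>B - {y}\<close> by the other colours can be glued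
    on.\<close>
  have hA: "h x \<in> Acc \<longleftrightarrow> x \<in> insert y A" if "x \<in> V" for x
  proof (cases "x = y \<or> x = z")
    case True
    then show ?thesis using X W TAcc soloD[OF zy] by (auto simp: h_def)
  next
    case False
    then have "h x = g x" "x \<in> insert y A \<longleftrightarrow> f x \<in> Acc" using that by (auto simp: h_def A_def)
    moreover have "g x \<in> Acc \<longleftrightarrow> f x \<in> Acc" using g(2,3)[of x] by (cases "f x \<in> Acc - {W}") auto
    ultimately show ?thesis by simp
  qed
  have "card (colour_class (insert y A) h e) = s" if e: "e \<in> Acc" for e
  proof -
    have "colour_class (insert y A) h e = colour_class V h e"
      using hA e yV by (auto simp: colour_class_def A_def)
    moreover have "card (colour_class V h e) = s"
    proof -
      have ze: "z \<in> colour_class V g e \<longleftrightarrow> e = W" and ye: "y \<notin> colour_class V g e"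
        using gz gy zV yV e by (auto simp: colour_class_def)
      have h: "colour_class V h e = (if e = W then insert y (cls W - {z}) else
          if e = X then insert z (colour_class V g e) else colour_class V g e)"
        using ze ye W(2) zy_ne zV yV gz clsW unfolding h_def
        by (auto simp: colour_class_def split: if_splits)
      have e_b: "e \<noteq> b" using e b_blocked by auto
      consider "e = W" | "e \<noteq> W" "e = X" | "e \<noteq> W" "e \<noteq> X" by blast
      then show ?thesis
      proof cases
        case 1
        have "z \<in> cls W" "y \<notin> cls W - {z}" using ze ye 1 clsW by auto
        then show ?thesis using h 1 card_T_class[OF W(1)] finV s_pos
          by (simp add: card.insert_remove)
      next
        case 2
        then show ?thesis using h ze finV g(5)[of e] card_a card_c[of e] e e_b AccC
          by (cases "e = a") auto
      next
        case 3
        then show ?thesis using h g(5)[of e] card_a card_c[of e] e e_b AccC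
          by (cases "e = a") auto
      qed
    qed
    ultimately show ?thesis by simp
  qed
  moreover have "proper (insert y A) E Acc h"
    using p2 hA yV unfolding proper_def A_def by auto
  ultimately have "equitable (insert y A) E Acc s h" by (simp add: equitable_def)
  moreover obtain g' where "equitable (B - {y}) E (C - Acc) s g'"
    using equitable_B[OF yV] by (auto simp: B_def)
  moreover have "insert y A \<union> (B - {y}) = V" "Acc \<union> (C - Acc) = C"
    using AB AccC yV by auto
  moreover have "insert y A \<inter> (B - {y}) = {}" using AB by auto
  ultimately show ?thesis
    using equitable_union[of "insert y A" E Acc s h "B - {y}" "C - Acc" g'] by auto
qed

text \<open>Recolour \<open>B - {y1}\<close> equitably, move \<open>z\<close> to a class
  \<open>Y\<close> there that is free of its neighbours, and put \<open>y1\<close> in its place;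
  \<open>Y\<close> becomes the large class. The old accessible colours remain accessible, and the
  new colour of \<open>y2\<close> joins them: \<open>y2\<close> has lost its only neighbour in class
  \<open>W\<close> and is not adjacent to \<open>y1\<close>.\<close>

lemma more_accessible:
  assumes z1: "solo z y1" and z2: "solo z y2" and y: "y1 \<noteq> y2" "\<not> E y1 y2"
    and nm: "\<And>X. X \<in> Acc - {f z} \<Longrightarrow> nbrs E (cls X) z \<noteq> {}"
  shows "\<exists>g b'. nearly_equitable V E C s g a b' \<and> card Acc < card (accessible V E C g a)"
proof -
  define W where "W = f z"
  have W: "W \<in> T" "W \<noteq> a" "W \<in> Acc" using soloD[OF z1] uT by (auto simp: W_def)
  have zV: "z \<in> V" and y1V: "y1 \<in> V" "f y1 \<notin> Acc" and y2V: "y2 \<in> V" "f y2 \<notin> Acc"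
    and ny1: "nbrs E (cls W) y1 = {z}" and ny2: "nbrs E (cls W) y2 = {z}"
    using z1 z2 by (auto simp: solo_def B_def W_def)
  obtain g where g: "equitable (B - {y1}) E (C - Acc) s g"
    using equitable_B[OF y1V] by (auto simp: B_def)
  have gC: "x \<in> B - {y1} \<Longrightarrow> g x \<in> C - Acc" for x
    using g by (auto simp: equitable_def proper_def)
  have gp: "\<lbrakk>x \<in> B - {y1}; x' \<in> B - {y1}; E x x'\<rbrakk> \<Longrightarrow> g x \<noteq> g x'" for x x'
    using g by (auto simp: equitable_def proper_def)
  \<comment> \<open>Having a neighbour in every other accessible class, \<open>z\<close> has at most
    \<open>card C - card Acc\<close> neighbours in \<open>B\<close>. One of them is
    \<open>y1\<close>, so some colour is free.\<close>
  have "\<exists>Y\<in>C - Acc. nbrs E (colour_class (B - {y1}) g Y) z = {}"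
  proof (rule ccontr)
    assume "\<not> ?thesis"
    then have "\<exists>x\<in>nbrs E (B - {y1}) z. g x = c" if "c \<in> C - Acc" for c
      using that by (force simp: nbrs_def colour_class_def)
    then have "C - Acc \<subseteq> g ` nbrs E (B - {y1}) z" by blast
    then have "card (C - Acc) \<le> card (nbrs E (B - {y1}) z)"
      using finB by (intro surj_card_le) auto
    moreover have "nbrs E (B - {y1}) z = nbrs E B z - {y1}" by (auto simp: nbrs_def)
    moreover have "y1 \<in> nbrs E B z" using soloD[OF z1] by (auto simp: nbrs_def)
    ultimately have "card (C - Acc) < card (nbrs E B z)"
      using finB by (metis card_Diff1_less finite_nbrs le_less_trans)
    moreover have "card (Acc - {W}) \<le> card (nbrs E A z)"
      using nm finAcc by (intro card_nbrs_A_ge) (auto simp: W_def)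
    moreover have "card (Acc - {W}) = card Acc - 1" using W by simp
    moreover have "card (C - Acc) = card C - card Acc" using AccC finAcc by (simp add: card_Diff_subset)
    ultimately show False using card_nbrs_split[of z] deg[OF zV] card_Acc_less by linarith
  qed
  then obtain Y where Y: "Y \<in> C - Acc" "nbrs E (colour_class (B - {y1}) g Y) z = {}" by blast
  define h where "h x = (if x = z then Y else if x = y1 then W else if x \<in> B then g x else f x)" for x
  have h_simps: "h z = Y" "h y1 = W" "\<And>x. x \<in> B - {y1} \<Longrightarrow> h x = g x"
    "\<And>x. x \<in> A - {z} \<Longrightarrow> h x = f x"
    using soloD[OF z1] AB y1V by (auto simp: h_def A_def)
  have region: "x = z \<or> x = y1 \<or> x \<in> B - {y1} \<or> x \<in> A - {z}" if "x \<in> V" for x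
    using that AB by auto
  have z_ne: "z \<noteq> y1" "z \<notin> B" "y1 \<notin> A" using soloD[OF z1] AB by auto
  have hC: "h x \<in> C" if "x \<in> V" for x
    using region[OF that] h_simps gC Y W AccC fC by (auto simp: A_def)
  have hAcc: "h x \<in> Acc \<longleftrightarrow> x = y1 \<or> x \<in> A - {z}" if "x \<in> V" for x
    using region[OF that] h_simps gC Y W z_ne by (auto simp: A_def B_def)
  have Ez: "h x \<noteq> Y" if "x \<in> V" "E z x" for x
  proof (cases "x \<in> B - {y1}")
    case True
    then show ?thesis using Y that h_simps(3) by (auto simp: nbrs_def colour_class_def)
  next
    case False
    moreover have "x \<noteq> z" using that irrefl_E by (auto dest: irreflpD)
    ultimately have "h x \<in> Acc" using that hAcc region by blast
    then show ?thesis using Y by auto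
  qed
  have Ey: "h x \<noteq> W" if "x \<in> V" "E y1 x" for x
  proof
    assume hx: "h x = W"
    have "x \<noteq> y1" using that irrefl_E by (auto dest: irreflpD)
    then have xA: "x \<in> A - {z}" using hAcc[OF that(1)] hx W by auto
    then have "x \<in> nbrs E (cls W) y1" using that hx h_simps(4) by (auto simp: nbrs_def colour_class_def)
    then show False using ny1 xA by auto
  qed
  have sy: "E x y \<longleftrightarrow> E y x" for x y using sym_E by (auto dest: sympD)
  have hne: "h x \<noteq> h y" if xy: "x \<in> V" "y \<in> V" "E x y" for x y
  proof -
    consider "x = z" | "y = z" | "x = y1" | "y = y1" | "x \<in> B - {y1}" "y \<in> B - {y1}"
      | "x \<in> A - {z}" "y \<in> A - {z}" | "h x \<in> Acc \<longleftrightarrow> h y \<notin> Acc"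
      using region[OF xy(1)] region[OF xy(2)] hAcc[OF xy(1)] hAcc[OF xy(2)] by metis
    then show ?thesis
    proof cases
      case 1
      then show ?thesis using Ez[of y] that h_simps(1) by auto
    next
      case 2
      then show ?thesis using Ez[of x] that h_simps(1) sy by auto
    next
      case 3
      then show ?thesis using Ey[of y] that h_simps(2) by auto
    next
      case 4
      then show ?thesis using Ey[of x] that h_simps(2) sy by auto
    next
      case 5
      then show ?thesis using gp h_simps(3) that by auto
    next
      case 6
      then show ?thesis using proper_f h_simps(4) that by (auto simp: proper_def A_def)
    next
      case 7
      then show ?thesis by metis
    qed
  qed
  have hprop: "proper V E C h" using hC hne by (auto simp: proper_def)
  have clsAcc: "colour_class V h c = cls c" if "c \<in> Acc - {W}" for c
  proof -
    have "h x = c \<longleftrightarrow> f x = c" if x: "x \<in> V" for x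
    proof -
      have "x = z \<or> x = y1 \<or> (x \<in> B \<and> h x \<notin> Acc) \<or> h x = f x"
        using region[OF x] h_simps gC by auto
      moreover have "f z = W" by (simp add: W_def)
      ultimately show ?thesis
        using \<open>c \<in> Acc - {W}\<close> h_simps(1,2) Y y1V by (auto simp: B_def)
    qed
    then show ?thesis by (auto simp: colour_class_def)
  qed
  have clsW: "colour_class V h W = insert y1 (cls W - {z})"
  proof -
    have "h x = W \<longleftrightarrow> x = y1 \<or> (f x = W \<and> x \<noteq> z)" if x: "x \<in> V" for x
    proof -
      consider "x = z" | "x = y1" | "x \<in> B - {y1}" | "x \<in> A - {z}" using region[OF x] by blast
      then show ?thesis
      proof cases
        case 1
        then show ?thesis using h_simps(1) Y W z_ne by auto
      next
        case 3
        then have "h x \<notin> Acc" "f x \<notin> Acc" using gC h_simps(3) by (auto simp: B_def)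
        then show ?thesis using 3 W by auto
      next
        case 4
        then show ?thesis using h_simps(4) z_ne by auto
      qed (use h_simps(2) in simp)
    qed
    then show ?thesis using y1V by (auto simp: colour_class_def)
  qed
  have clsB: "colour_class V h c = colour_class (B - {y1}) g c \<union> (if c = Y then {z} else {})"
    if c: "c \<in> C - Acc" for c
  proof -
    have "h x = c \<longleftrightarrow> (x \<in> B - {y1} \<and> g x = c) \<or> (x = z \<and> c = Y)" if x: "x \<in> V" for x
    proof -
      consider "x = z" | "x = y1" | "x \<in> B - {y1}" | "x \<in> A - {z}" using region[OF x] by blast
      then show ?thesis
      proof cases
        case 1
        then show ?thesis using h_simps(1) z_ne by auto
      next
        case 2
        then show ?thesis using h_simps(2) z_ne W c by auto
      next
        case 3
        then show ?thesis using h_simps(3) z_ne by auto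
      next
        case 4
        then have "h x \<in> Acc" "x \<notin> B" using hAcc[OF x] AB by auto
        then show ?thesis using 4 c by auto
      qed
    qed
    then show ?thesis using zV AB by (auto simp: colour_class_def)
  qed
  have card_W: "card (colour_class V h W) = s"
  proof -
    have "z \<in> cls W" "y1 \<notin> cls W - {z}" using zV y1V W by (auto simp: colour_class_def W_def)
    then show ?thesis using clsW card_T_class[OF W(1)] finV s_pos
      by (simp add: card.insert_remove)
  qed
  have z_nB: "z \<notin> colour_class (B - {y1}) g c" for c
    using soloD[OF z1] by (auto simp: colour_class_def)
  have card_B': "card (colour_class (B - {y1}) g c) = s" if "c \<in> C - Acc" for c
    using g that by (auto simp: equitable_def)
  have "nearly_equitable V E C s h a Y"
  proof unfold_locales
    show "Suc (card (colour_class V h a)) = s" using clsAcc[of a] aAcc W card_a by auto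
    show "card (colour_class V h Y) = Suc s"
      using clsB[OF Y(1)] card_B'[OF Y(1)] z_nB finB by simp
    show "card (colour_class V h c) = s" if c: "c \<in> C" "c \<noteq> a" "c \<noteq> Y" for c
    proof -
      consider "c = W" | "c \<in> Acc - {W}" | "c \<in> C - Acc" using c by blast
      then show ?thesis
      proof cases
        case 2
        moreover have "c \<noteq> b" using 2 b_blocked by auto
        ultimately show ?thesis using clsAcc card_c c by auto
      qed (use card_W clsB card_B' c in auto)
    qed
  qed (use hprop aC Y in auto)
  moreover have "card Acc < card (accessible V E C h a)"
  proof -
    let ?H = "move_rel V E h"
    \<comment> \<open>The accessible classes other than \<open>W\<close> are unchanged, so the paths
      avoiding \<open>W\<close> that \<open>terminal\<close> provides survive.\<close>
    have sub: "H \<inter> (Acc - {W}) \<times> (Acc - {W}) \<subseteq> ?H \<inter> C \<times> C"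
    proof (rule subrelI)
      fix c d assume "(c, d) \<in> H \<inter> (Acc - {W}) \<times> (Acc - {W})"
      moreover from this have "colour_class V h c = cls c" "colour_class V h d = cls d"
        by (intro clsAcc; simp)+
      ultimately show "(c, d) \<in> ?H \<inter> C \<times> C" using AccC by (auto simp: move_rel_def)
    qed
    have 1: "reaches ?H C c a" if "c \<in> Acc - {W}" for c
      using terminal[OF W(1) that] rtrancl_mono[OF sub] by blast
    have 2: "reaches ?H C W a"
    proof -
      obtain X where X: "X \<in> Acc - {W}" "(W, X) \<in> H"
        using reaches_leave[OF reaches_Acc[OF W(3)] W(2)] by blast
      then obtain w where w: "w \<in> cls W" "nbrs E (cls X) w = {}" by (auto simp: move_rel_def)
      \<comment> \<open>The vertex that could leave \<open>W\<close> is not the immovable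
        \<open>z\<close>, so it is still there.\<close>
      then have "w \<noteq> z" using nm X by (auto simp: W_def)
      then have "(W, X) \<in> ?H" using w clsW clsAcc[OF X(1)] by (auto simp: move_rel_def)
      then have "(W, X) \<in> ?H \<inter> C \<times> C" using W X AccC by auto
      then show ?thesis using 1[OF X(1)] by (meson converse_rtrancl_into_rtrancl)
    qed
    have y2: "y2 \<in> B - {y1}" using y y2V by (auto simp: B_def)
    have 3: "reaches ?H C (g y2) a"
    proof -
      have "nbrs E (colour_class V h W) y2 = {}"
        using clsW ny2 y(2) sy by (auto simp: nbrs_def)
      moreover have "y2 \<in> colour_class V h (g y2)"
        using y2V h_simps(3)[OF y2] by (simp add: colour_class_def)
      ultimately have "(g y2, W) \<in> ?H" by (auto simp: move_rel_def)
      then have "(g y2, W) \<in> ?H \<inter> C \<times> C" using W AccC gC[OF y2] by auto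
      then show ?thesis using 2 by (meson converse_rtrancl_into_rtrancl)
    qed
    have "insert (g y2) Acc \<subseteq> accessible V E C h a"
      using 1 2 3 AccC gC[OF y2] unfolding accessible_def by blast
    moreover have "finite (accessible V E C h a)" using finC by (simp add: accessible_def)
    moreover have "card (insert (g y2) Acc) = Suc (card Acc)" using finAcc gC[OF y2] by simp
    ultimately show ?thesis by (metis Suc_le_eq card_mono)
  qed
  ultimately show ?thesis by blast
qed

lemma card_nbrs_B_unmovable:
  assumes "z \<in> V" "f z \<in> T" "\<And>X. X \<in> Acc - {f z} \<Longrightarrow> nbrs E (cls X) z \<noteq> {}"
  shows "card (nbrs E B z) \<le> q"
proof -
  have "card (Acc - {f z}) \<le> card (nbrs E A z)"
    using assms finAcc by (intro card_nbrs_A_ge) auto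
  moreover have "card (Acc - {f z}) = card Acc - 1" using assms TAcc by auto
  ultimately show ?thesis using card_nbrs_split[of z] deg[OF assms(1)] by (simp add: q_def)
qed

text \<open>Suppose \<open>card T \<le> q\<close> and take \<open>W\<close> in \<open>T\<close>. The
  vertices of \<open>W\<close> with a solo partner have at most \<open>q\<close> neighbours in
  \<open>B\<close> each. A vertex of \<open>B\<close> not adjacent to any of them has two neighbours
  in the rest \<open>D\<close> of \<open>W\<close>, whose vertices have at most \<open>2 * q\<close>
  neighbours in \<open>B\<close>. So \<open>B\<close> has at most \<open>s * q\<close> vertices, one
  too few.\<close>

lemma card_T_greater:
  assumes nm: "\<And>z y X. solo z y \<Longrightarrow> X \<in> Acc - {f z} \<Longrightarrow> nbrs E (cls X) z \<noteq> {}"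
  shows "q < card T"
proof (rule ccontr)
  assume le: "\<not> ?thesis"
  obtain W where W: "W \<in> T" using uT by blast
  define S where "S = {z \<in> cls W. \<exists>y. solo z y}"
  define D where "D = cls W - S"
  define NS where "NS = {y \<in> B. nbrs E S y \<noteq> {}}"
  have fin: "finite S" "finite D" "finite NS" using finV finB by (auto simp: S_def D_def NS_def)
  have SD: "card S + card D = s"
  proof -
    have "S \<union> D = cls W" "S \<inter> D = {}" by (auto simp: S_def D_def)
    then show ?thesis using card_Un_disjoint[OF fin(1,2)] card_T_class[OF W] by simp
  qed
  have "NS \<subseteq> (\<Union>z\<in>S. nbrs E B z)" using sym_E by (auto simp: NS_def nbrs_def dest: sympD)
  then have "card NS \<le> card (\<Union>z\<in>S. nbrs E B z)" using fin finB by (intro card_mono) auto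
  also have "\<dots> \<le> (\<Sum>z\<in>S. card (nbrs E B z))" using fin by (intro card_UN_le)
  also have "\<dots> \<le> (\<Sum>z\<in>S. q)"
    using nm W by (intro sum_mono card_nbrs_B_unmovable) (auto simp: S_def colour_class_def)
  finally have NS: "card NS \<le> card S * q" by simp
  have two: "2 \<le> card (nbrs E D y)" if y: "y \<in> B - NS" for y
  proof -
    have "nbrs E (cls W) y = nbrs E D y" using y by (auto simp: NS_def D_def nbrs_def)
    moreover have "nbrs E (cls W) y \<noteq> {}" using y blocked_nbr W TAcc by auto
    moreover have "card (nbrs E (cls W) y) \<noteq> 1"
    proof
      \<comment> \<open>A single neighbour in \<open>W\<close> would be solo for \<open>y\<close>
        and hence lie in \<open>S\<close>.\<close>
      assume "card (nbrs E (cls W) y) = 1"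
      then obtain z where z: "nbrs E (cls W) y = {z}" by (auto simp: card_1_singleton_iff)
      then have "z \<in> V" "f z = W" "z \<in> cls W" "E y z" by (auto simp: nbrs_def colour_class_def)
      then have "solo z y" using z y W by (auto simp: solo_def)
      then have "z \<in> S" using \<open>z \<in> cls W\<close> by (auto simp: S_def)
      then show False using \<open>E y z\<close> y by (auto simp: NS_def nbrs_def)
    qed
    moreover have "finite (nbrs E D y)" using fin by simp
    ultimately show ?thesis by (metis One_nat_def Suc_1 card_0_eq le_SucE not_less_eq_eq le_zero_eq)
  qed
  have "2 * card (B - NS) = (\<Sum>y\<in>B - NS. 2)" by simp
  also have "\<dots> \<le> (\<Sum>y\<in>B - NS. card (nbrs E D y))" using two by (intro sum_mono)
  also have "\<dots> \<le> (\<Sum>y\<in>B. card (nbrs E D y))" using finB by (intro sum_mono2) auto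
  also have "\<dots> = (\<Sum>x\<in>D. card (nbrs E B x))" using fin finB sym_E by (intro double_count)
  also have "\<dots> \<le> (\<Sum>x\<in>D. card T + q)"
    using W by (intro sum_mono card_nbrs_B_T) (auto simp: D_def colour_class_def)
  also have "\<dots> \<le> (\<Sum>x\<in>D. 2 * q)" using le by (intro sum_mono) auto
  finally have "card (B - NS) \<le> card D * q" by simp
  moreover have "card (B - NS) = card B - card NS" using fin by (intro card_Diff_subset) (auto simp: NS_def)
  ultimately have "card B \<le> (card S + card D) * q" using NS by (simp add: algebra_simps)
  then show False using card_B SD by (simp add: q_def mult.commute)
qed

text \<open>If there were none, the \<open>y\<close> with \<open>solo z y\<close> would form a clique for each \<open>z\<close>.  Give such a
  pair the weight \<open>q\<close> divided by the order of the clique: each \<open>z\<close> carries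
  at most \<open>q\<close>, but each \<open>y\<close> at least \<open>card T\<close>.\<close>

lemma nonadjacent_special_nbrs:
  assumes nm: "\<And>z y X. solo z y \<Longrightarrow> X \<in> Acc - {f z} \<Longrightarrow> nbrs E (cls X) z \<noteq> {}"
  obtains z y1 y2 where "solo z y1" "solo z y2" "y1 \<noteq> y2" "\<not> E y1 y2"
proof (rule ccontr)
  note found = that
  assume not_thesis: "\<not> thesis"
  have clique: "E y1 y2" if "solo z y1" "solo z y2" "y1 \<noteq> y2" for z y1 y2
    using that found not_thesis by blast
  have qT: "q < card T" using card_T_greater nm by blast
  define A' where "A' = {z \<in> V. f z \<in> T}"
  define w :: "'a \<Rightarrow> real" where "w z = real q / real (card {y \<in> B. solo z y})" for z
  have finA': "finite A'" using finV by (simp add: A'_def)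
  have solo_A': "{z. z \<in> A' \<and> solo z y} = {z \<in> V. solo z y}" for y
    by (auto simp: A'_def solo_def)
  have "real (card T) * real (card B) = (\<Sum>y\<in>B. real (card T))" by simp
  also have "\<dots> \<le> (\<Sum>y\<in>B. \<Sum>z | z \<in> A' \<and> solo z y. w z)"
  proof (rule sum_mono)
    fix y assume y: "y \<in> B"
    \<comment> \<open>For every \<open>z\<close> with \<open>solo z y\<close>, the clique of solo
      partners of \<open>z\<close> consists of \<open>y\<close> and some of its neighbours in
      \<open>B\<close>, so \<open>d\<close> bounds its order.\<close>
    define d where "d = Suc (card (nbrs E B y))"
    have d: "d \<le> q" "card T + d \<le> q + card {z \<in> V. solo z y}" "0 < d"
      using card_nbrs_B_less[OF y] card_solo_ge[OF y] by (auto simp: d_def q_def)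
    have wd: "real q / real d \<le> w z" if z: "z \<in> {z \<in> V. solo z y}" for z
    proof -
      have "{y' \<in> B. solo z y'} \<subseteq> insert y (nbrs E B y)"
        using clique[of z y] z by (auto simp: nbrs_def)
      then have "card {y' \<in> B. solo z y'} \<le> card (insert y (nbrs E B y))"
        using finB by (intro card_mono) auto
      also have "\<dots> \<le> d" by (simp add: card_insert_if d_def finB)
      finally have "card {y' \<in> B. solo z y'} \<le> d" .
      moreover have "0 < card {y' \<in> B. solo z y'}" using y z finB by (auto simp: card_gt_0_iff)
      ultimately show ?thesis unfolding w_def by (intro divide_left_mono) auto
    qed
    \<comment> \<open>A rearrangement of the inequality
      \<open>0 \<le> (card T - q) * (q - d)\<close>.\<close>
    have "real (card T) * real d \<le> (real (card T) - real q + real d) * real q"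
    proof -
      have "0 \<le> (real (card T) - real q) * (real q - real d)" using d qT by simp
      then show ?thesis by (simp add: algebra_simps)
    qed
    also have "\<dots> \<le> real (card {z \<in> V. solo z y}) * real q"
      using d(2) by (intro mult_right_mono) linarith+
    finally have "real (card T) \<le> real (card {z \<in> V. solo z y}) * (real q / real d)"
      using d(3) by (simp add: field_simps)
    also have "\<dots> = (\<Sum>z\<in>{z \<in> V. solo z y}. real q / real d)" by simp
    also have "\<dots> \<le> (\<Sum>z\<in>{z \<in> V. solo z y}. w z)" using wd by (intro sum_mono)
    finally show "real (card T) \<le> (\<Sum>z | z \<in> A' \<and> solo z y. w z)" by (simp only: solo_A')
  qed
  also have "\<dots> = (\<Sum>z\<in>A'. \<Sum>y | y \<in> B \<and> solo z y. w z)"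
    using finB finA' by (rule sum.swap_restrict)
  \<comment> \<open>The weights at \<open>z\<close> add up to \<open>q\<close>, or to 0 if
    \<open>z\<close> has no solo partner.\<close>
  also have "\<dots> \<le> (\<Sum>z\<in>A'. real q)" by (intro sum_mono) (auto simp: w_def)
  also have "\<dots> = real (card T * s) * real q"
    using card_fibres[OF finV finT, of f] card_T_class by (simp add: A'_def)
  finally have "real (card T) * real (card B) \<le> real (card T * s) * real q" .
  then have "card T * card B \<le> card T * s * q"
    unfolding of_nat_mult[symmetric] of_nat_le_iff .
  then show False using card_B qT by (simp add: q_def algebra_simps)
qed

lemma progress:
  "(\<exists>g. equitable V E C s g) \<or>
   (\<exists>g b'. nearly_equitable V E C s g a b' \<and> card Acc < card (accessible V E C g a))"
proof (cases "\<exists>z y X. solo z y \<and> X \<in> Acc - {f z} \<and> nbrs E (cls X) z = {}")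
  case True
  then show ?thesis using equitable_of_movable_solo by blast
next
  case False
  then have nm: "nbrs E (cls X) z \<noteq> {}" if "solo z y" "X \<in> Acc - {f z}" for z y X using that by blast
  obtain z y1 y2 where "solo z y1" "solo z y2" "y1 \<noteq> y2" "\<not> E y1 y2"
    using nonadjacent_special_nbrs nm by metis
  then show ?thesis using more_accessible nm by blast
qed

end

section \<open>The Hajnal-Szemeredi theorem by induction on the number of edges\<close>

lemma equal_partition:
  assumes "finite C" "finite V" "card V = s * card C"
  shows "\<exists>f. f ` V \<subseteq> C \<and> (\<forall>c\<in>C. card (colour_class V f c) = s)"
  using assms
proof (induction C arbitrary: V rule: finite_induct)
  case empty
  then show ?case by auto
next
  case (insert c C)
  then have "s \<le> card V" by simp
  then obtain U where U: "U \<subseteq> V" "card U = s" by (meson obtain_subset_with_card_n)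
  then have "card (V - U) = s * card C"
    using insert by (simp add: card_Diff_subset finite_subset)
  then obtain f where f: "f ` (V - U) \<subseteq> C" "\<And>d. d \<in> C \<Longrightarrow> card (colour_class (V - U) f d) = s"
    using insert.IH[of "V - U"] insert.prems by auto
  let ?g = "\<lambda>x. if x \<in> U then c else f x"
  have "colour_class V ?g c = U" using f(1) U(1) insert.hyps by (auto simp: colour_class_def)
  moreover have "colour_class V ?g d = colour_class (V - U) f d" if "d \<in> C" for d
    using that insert.hyps by (auto simp: colour_class_def)
  ultimately show ?case using f U by (intro exI[of _ ?g]) auto
qed

text \<open>Ordered pairs count each edge twice, which is harmless in an induction measure.\<close>

definition edges_in :: "('a \<Rightarrow> 'a \<Rightarrow> bool) \<Rightarrow> 'a set \<Rightarrow> ('a \<times> 'a) set" where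
  "edges_in E V = {(x, y) \<in> V \<times> V. E x y}"

lemma finite_edges_in: "finite V \<Longrightarrow> finite (edges_in E V)"
  unfolding edges_in_def by (rule finite_subset[of _ "V \<times> V"]) auto

text \<open>The assumption is the induction hypothesis on edges. It is spent on \<open>B\<close>
  without one vertex, coloured by the inaccessible colours, and so supplies
  \<open>equitable_B\<close>.\<close>

lemma (in nearly_equitable) equitable_or_progress:
  assumes IH: "\<And>V' C'. \<lbrakk>bounded_degree V' E C'; edges_in E V' \<subset> edges_in E V; card V' = s * card C'\<rbrakk>
    \<Longrightarrow> \<exists>g. equitable V' E (C' :: 'c set) s g"
  shows "(\<exists>g. equitable V E C s g) \<or>
    (\<exists>g b'. nearly_equitable V E C s g a b' \<and> card Acc < card (accessible V E C g a))"
proof (cases "b \<in> Acc")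
  case True
  then show ?thesis using equitable_of_accessible by blast
next
  case False
  then interpret nearly_equitable_blocked V E C s f a b by unfold_locales
  obtain u T where uT: "u \<in> Acc" "T \<subseteq> Acc - {u}" "T \<noteq> {}" "a \<notin> T"
    "\<And>w x. \<lbrakk>w \<in> T; x \<in> Acc - {w}\<rbrakk> \<Longrightarrow> reaches H (Acc - {w}) x a"
    "\<And>w x. \<lbrakk>w \<in> T; x \<in> Acc - {u} - T\<rbrakk> \<Longrightarrow> (w, x) \<notin> H"
    by (rule terminal_family[OF finAcc aAcc Acc_neq reaches_Acc]) (assumption, (rule that; assumption))
  have "\<exists>g. equitable (B - {y}) E (C - Acc) s g" if y: "y \<in> B" for y
  proof (rule IH)
    show "bounded_degree (B - {y}) E (C - Acc)"
    proof
      show "card (nbrs E (B - {y}) x) < card (C - Acc)" if "x \<in> B - {y}" for x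
      proof -
        have "card (nbrs E (B - {y}) x) \<le> card (nbrs E B x)"
          using finB by (intro card_mono) (auto simp: nbrs_def)
        also have "\<dots> < card C - card Acc" using card_nbrs_B_less that by simp
        finally show ?thesis using AccC finAcc by (simp add: card_Diff_subset)
      qed
    qed (use finB finC sym_E irrefl_E in auto)
    show "card (B - {y}) = s * card (C - Acc)"
      using card_B y finB AccC finAcc by (simp add: card_Diff_subset)
    \<comment> \<open>An edge is lost because \<open>y\<close> has a neighbour in class
      \<open>a\<close>, outside \<open>B\<close>.\<close>
    obtain x where "x \<in> A" "E y x"
      using blocked_nbr[OF y aAcc] aAcc by (auto simp: nbrs_def colour_class_def A_def)
    then have "(y, x) \<in> edges_in E V - edges_in E (B - {y})" using y AB by (auto simp: edges_in_def)
    moreover have "edges_in E (B - {y}) \<subseteq> edges_in E V" using AB by (auto simp: edges_in_def)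
    ultimately show "edges_in E (B - {y}) \<subset> edges_in E V" by blast
  qed
  then interpret kierstead_kostochka V E C s f a b u T
    using uT by unfold_locales (auto simp: B_def)
  show ?thesis by (rule progress)
qed

text \<open>Every round that does not finish makes more colours accessible, and there are only
  \<open>card C\<close> of them. The small class \<open>a\<close> stays the same while the large one
  may change.\<close>

lemma equitable_of_nearly_equitable:
  fixes C :: "'c set"
  assumes "nearly_equitable V E C s f a b"
    and IH: "\<And>V' C'. \<lbrakk>bounded_degree V' E C'; edges_in E V' \<subset> edges_in E V; card V' = s * card C'\<rbrakk>
      \<Longrightarrow> \<exists>g. equitable V' E (C' :: 'c set) s g"
  shows "\<exists>g. equitable V E C s g"
  using assms(1)
proof (induction "card C - card (accessible V E C f a)" arbitrary: f b rule: less_induct)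
  case less
  interpret nearly_equitable V E C s f a b by (rule less.prems)
  have "(\<exists>g. equitable V E C s g) \<or>
    (\<exists>g b'. nearly_equitable V E C s g a b' \<and> card Acc < card (accessible V E C g a))"
    using IH by (rule equitable_or_progress)
  then show ?case
  proof (elim disjE exE conjE)
    fix g b' assume g: "nearly_equitable V E C s g a b'" and less_Acc: "card Acc < card (accessible V E C g a)"
    have "accessible V E C g a \<subseteq> C" by (auto simp: accessible_def)
    then have "card (accessible V E C g a) \<le> card C" using finC by (intro card_mono)
    then have "card C - card (accessible V E C g a) < card C - card Acc" using less_Acc by linarith
    then show ?thesis using g by (rule less.hyps)
  qed blast
qed

text \<open>Delete all edges at some \<open>u\<close>, colour by induction, and restore the edges.
  Having fewer neighbours than there are colours, \<open>u\<close> can go to a class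
  \<open>d\<close> free of them. Unless \<open>d\<close> is its old class, this leaves the old class
  one short and \<open>d\<close> one too large.\<close>

theorem hajnal_szemeredi:
  fixes V :: "'a set" and C :: "'c set"
  assumes "bounded_degree V E C" "card V = s * card C"
  shows "\<exists>f. equitable V E C s f"
  using assms
proof (induction "card (edges_in E V)" arbitrary: V E C rule: less_induct)
  case less
  interpret bounded_degree V E C by (rule less.prems)
  show ?case
  proof (cases "\<exists>u\<in>V. nbrs E V u \<noteq> {}")
    case False
    obtain f where "f ` V \<subseteq> C" "\<forall>c\<in>C. card (colour_class V f c) = s"
      using equal_partition[OF finC finV less.prems(2)] by blast
    then show ?thesis using False
      by (intro exI[of _ f]) (auto simp: equitable_def proper_def nbrs_def)
  next
    case True
    then obtain u v where uv: "u \<in> V" "v \<in> V" "E u v" by (auto simp: nbrs_def)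
    define E' where "E' x y \<longleftrightarrow> E x y \<and> x \<noteq> u \<and> y \<noteq> u" for x y
    have "edges_in E' V \<subseteq> edges_in E V" "(u, v) \<in> edges_in E V - edges_in E' V"
      using uv by (auto simp: edges_in_def E'_def)
    then have "edges_in E' V \<subset> edges_in E V" by blast
    then have "card (edges_in E' V) < card (edges_in E V)"
      by (intro psubset_card_mono finite_edges_in finV)
    moreover have "bounded_degree V E' C"
    proof
      show "card (nbrs E' V x) < card C" if "x \<in> V" for x
      proof -
        have "card (nbrs E' V x) \<le> card (nbrs E V x)"
          using finV by (intro card_mono) (auto simp: nbrs_def E'_def)
        then show ?thesis using deg[OF that] by simp
      qed
    qed (use finV finC sym_E irrefl_E in \<open>auto simp: E'_def symp_def irreflp_def\<close>)
    ultimately obtain f where f: "equitable V E' C s f" using less.hyps less.prems(2) by blast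
    then have fu: "f u \<in> C" and fp: "proper V E' C f" using uv by (auto simp: equitable_def proper_def)
    have "\<exists>d\<in>C. nbrs E (colour_class V f d) u = {}"
    proof (rule ccontr)
      assume "\<not> ?thesis"
      then have "\<exists>x\<in>nbrs E V u. f x = d" if "d \<in> C" for d
        using that by (force simp: nbrs_def colour_class_def)
      then have "C \<subseteq> f ` nbrs E V u" by blast
      then have "card C \<le> card (nbrs E V u)" using finV by (intro surj_card_le) auto
      then show False using deg[OF uv(1)] by simp
    qed
    then obtain d where d: "d \<in> C" "nbrs E (colour_class V f d) u = {}" by blast
    have "f x \<noteq> f y" if "x \<in> V" "y \<in> V" "E x y" "x \<noteq> u" "y \<noteq> u" for x y
      using fp that by (auto simp: proper_def E'_def)
    moreover have "f x \<noteq> d" if "x \<in> V" "E u x" for x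
      using d(2) that by (auto simp: nbrs_def colour_class_def)
    moreover have "f x \<noteq> d" if "x \<in> V" "E x u" for x
      using calculation(2) that sym_E by (auto dest: sympD)
    ultimately have gp: "proper V E C (f(u := d))"
      using fp d(1) irrefl_E by (auto simp: proper_def dest: irreflpD)
    show ?thesis
    proof (cases "d = f u")
      case True
      then have "f(u := d) = f" by auto
      then show ?thesis using gp f by (auto simp: equitable_def)
    next
      case False
      have cards: "card (colour_class V f c) = s" if "c \<in> C" for c using f that by (auto simp: equitable_def)
      have u_cls: "u \<in> colour_class V f c \<longleftrightarrow> c = f u" for c using uv by (auto simp: colour_class_def)
      have "nearly_equitable V E C s (f(u := d)) (f u) d"
      proof unfold_locales
        have "0 < card (colour_class V f (f u))" using u_cls finV by (auto simp: card_gt_0_iff)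
        then show "Suc (card (colour_class V (f(u := d)) (f u))) = s"
          using False u_cls finV cards[OF fu] by (simp add: colour_class_upd[OF uv(1)])
        show "card (colour_class V (f(u := d)) d) = Suc s"
          using False u_cls finV cards[OF d(1)] by (simp add: colour_class_upd[OF uv(1)])
        show "card (colour_class V (f(u := d)) c) = s" if "c \<in> C" "c \<noteq> f u" "c \<noteq> d" for c
          using that u_cls cards by (simp add: colour_class_upd[OF uv(1)])
      qed (use gp fu d in auto)
      then show ?thesis
      proof (rule equitable_of_nearly_equitable)
        fix V' and C' :: "'c set"
        assume V': "bounded_degree V' E C'" "edges_in E V' \<subset> edges_in E V" "card V' = s * card C'"
        then have "card (edges_in E V') < card (edges_in E V)"
          by (intro psubset_card_mono finite_edges_in finV)
        then show "\<exists>g. equitable V' E C' s g" using less.hyps V' by blast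
      qed
    qed
  qed
qed

section \<open>Tilings by transitive tournaments\<close>

text \<open>A transitive tournament is given by the list of its vertices in transitive order.\<close>

inductive tiling :: "('a \<Rightarrow> 'a \<Rightarrow> bool) \<Rightarrow> nat \<Rightarrow> 'a set \<Rightarrow> bool" for E k where
  empty: "tiling E k {}"
| add: "\<lbrakk>tiling E k S; distinct xs; length xs = k; sorted_wrt E xs; set xs \<inter> S = {}\<rbrakk>
    \<Longrightarrow> tiling E k (set xs \<union> S)"

definition total_in :: "('a \<Rightarrow> 'a \<Rightarrow> bool) \<Rightarrow> 'a set \<Rightarrow> bool" where
  "total_in E S \<longleftrightarrow> (\<forall>x\<in>S. \<forall>y\<in>S. x \<noteq> y \<longrightarrow> E x y \<or> E y x)"

lemma total_in_subset: "total_in E S \<Longrightarrow> S' \<subseteq> S \<Longrightarrow> total_in E S'"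
  by (auto simp: total_in_def)

lemma tiling_union:
  assumes "tiling E k S" "tiling E k S'" "S \<inter> S' = {}"
  shows "tiling E k (S \<union> S')"
  using assms
proof (induction rule: tiling.induct)
  case (add S xs)
  then have "tiling E k (set xs \<union> (S \<union> S'))" by (intro tiling.add) auto
  then show ?case by (simp add: Un_assoc)
qed simp

lemma tiling_UN:
  assumes "finite I" "\<And>i. i \<in> I \<Longrightarrow> tiling E k (F i)"
    "\<And>i j. \<lbrakk>i \<in> I; j \<in> I; i \<noteq> j\<rbrakk> \<Longrightarrow> F i \<inter> F j = {}"
  shows "tiling E k (\<Union>i\<in>I. F i)"
  using assms
proof (induction rule: finite_induct)
  case empty
  then show ?case by (simp add: tiling.empty)
next
  case (insert i I)
  have "F i \<inter> (\<Union>i\<in>I. F i) = {}" using insert by fastforce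
  then show ?case using insert by (auto intro!: tiling_union)
qed

lemma tiling_set:
  assumes "distinct xs" "sorted_wrt E xs" "k dvd length xs" "0 < k"
  shows "tiling E k (set xs)"
  using assms
proof (induction "length xs" arbitrary: xs rule: less_induct)
  case less
  show ?case
  proof (cases "xs = []")
    case False
    then have le: "k \<le> length xs" using less.prems by (auto intro: dvd_imp_le)
    have "tiling E k (set (drop k xs))"
      using less.prems le False by (intro less.hyps) (auto simp: sorted_wrt_drop intro: dvd_diff_nat)
    then have "tiling E k (set (take k xs) \<union> set (drop k xs))"
      using less.prems le by (intro tiling.add) (auto simp: sorted_wrt_take set_take_disj_set_drop_if_distinct)
    then show ?thesis by (metis append_take_drop_id set_append)
  qed (simp add: tiling.empty)
qed

lemma tiling_image:
  assumes "tiling E k S" "inj_on h S" "\<And>x y. \<lbrakk>x \<in> S; y \<in> S; E x y\<rbrakk> \<Longrightarrow> E' (h x) (h y)"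
  shows "tiling E' k (h ` S)"
  using assms
proof (induction rule: tiling.induct)
  case (add S xs)
  have "tiling E' k (set (map h xs) \<union> h ` S)"
  proof (rule tiling.add)
    show "tiling E' k (h ` S)" using add by (auto simp: inj_on_Un)
    show "distinct (map h xs)" using add by (auto simp: distinct_map inj_on_Un)
    show "sorted_wrt E' (map h xs)"
      using add.hyps(4) add.prems(2) by (auto simp: sorted_wrt_map intro: sorted_wrt_mono_rel)
    show "set (map h xs) \<inter> h ` S = {}"
      using add.prems(1) add.hyps(5) inj_on_image_Int[of h "set xs \<union> S" "set xs" S] by auto
  qed (use add in simp)
  then show ?case by (simp add: image_Un)
qed (simp add: tiling.empty)

text \<open>Any vertex \<open>v\<close> dominates, or is dominated by, at least half of the others.
  Recurse on these and put \<open>v\<close> first or last.\<close>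

lemma ex_transitive:
  assumes "finite S" "total_in E S" "2 ^ n \<le> card S"
  shows "\<exists>xs. distinct xs \<and> length xs = n \<and> sorted_wrt E xs \<and> set xs \<subseteq> S"
  using assms
proof (induction n arbitrary: S)
  case (Suc n)
  then have "S \<noteq> {}" by auto
  then obtain v where v: "v \<in> S" by blast
  define U where "U = {x \<in> S - {v}. E v x}"
  define W where "W = {x \<in> S - {v}. E x v}"
  have fin: "finite U" "finite W" using Suc.prems by (auto simp: U_def W_def)
  have "S - {v} \<subseteq> U \<union> W" using Suc.prems(2) v by (auto simp: U_def W_def total_in_def)
  then have "card (S - {v}) \<le> card (U \<union> W)" using fin by (intro card_mono) auto
  also have "\<dots> \<le> card U + card W" by (rule card_Un_le)
  finally have "2 * 2 ^ n \<le> Suc (card U + card W)" using Suc.prems v by simp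
  then consider "2 ^ n \<le> card U" | "2 ^ n \<le> card W" by linarith
  then show ?case
  proof cases
    case 1
    then obtain xs where "distinct xs" "length xs = n" "sorted_wrt E xs" "set xs \<subseteq> U"
      using Suc.IH[of U] fin Suc.prems(2) total_in_subset[of E S U] by (auto simp: U_def)
    then show ?thesis using v by (intro exI[of _ "v # xs"]) (auto simp: U_def)
  next
    case 2
    then obtain xs where "distinct xs" "length xs = n" "sorted_wrt E xs" "set xs \<subseteq> W"
      using Suc.IH[of W] fin Suc.prems(2) total_in_subset[of E S W] by (auto simp: W_def)
    then show ?thesis using v by (intro exI[of _ "xs @ [v]"]) (auto simp: W_def sorted_wrt_append)
  qed
qed simp

text \<open>As long as \<open>2 ^ k\<close> vertices are left, \<open>ex_transitive\<close> yields
  another tile.\<close>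

lemma greedy_tiling:
  assumes "finite S" "total_in E S" "0 < k"
  shows "\<exists>R\<subseteq>S. card R < 2 ^ k \<and> tiling E k (S - R)"
  using assms
proof (induction "card S" arbitrary: S rule: less_induct)
  case less
  show ?case
  proof (cases "card S < 2 ^ k")
    case True
    then show ?thesis by (intro exI[of _ S]) (auto simp: tiling.empty)
  next
    case False
    then obtain xs where xs: "distinct xs" "length xs = k" "sorted_wrt E xs" "set xs \<subseteq> S"
      using ex_transitive[of S E k] less.prems by auto
    then obtain x where "x \<in> set xs" using less.prems(3) by fastforce
    then have "S - set xs \<subset> S" using xs(4) by blast
    then have "card (S - set xs) < card S" using less.prems(1) by (intro psubset_card_mono)
    then obtain R where R: "R \<subseteq> S - set xs" "card R < 2 ^ k" "tiling E k (S - set xs - R)"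
      using less.hyps[of "S - set xs"] less.prems total_in_subset[of E S "S - set xs"] by auto
    have "tiling E k (set xs \<union> (S - set xs - R))" using R xs by (intro tiling.add) auto
    moreover have "set xs \<union> (S - set xs - R) = S - R" using R xs by auto
    ultimately show ?thesis using R by auto
  qed
qed

text \<open>A vertex outside a long transitive tournament completes \<open>k - 1\<close> of its vertices to a
  transitive tournament, since it dominates, or is dominated by, half of them.\<close>

lemma tiling_absorb:
  assumes "finite R" "distinct xs" "sorted_wrt E xs" "R \<inter> set xs = {}" "total_in E (R \<union> set xs)"
    and "2 * k * card R \<le> length xs" "k dvd card R + length xs" "0 < k"
  shows "tiling E k (R \<union> set xs)"
  using assms
proof (induction R arbitrary: xs rule: finite_induct)
  case empty
  then show ?case by (simp add: tiling_set)
next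
  case (insert v R)
  have tot: "E v x \<or> E x v" if "x \<in> set xs" for x
    using that insert.prems(3,4) by (auto simp: total_in_def)
  have len: "2 * k + 2 * k * card R \<le> length xs" using insert by (simp add: algebra_simps)
  have "length xs = length (filter (E v) xs) + length (filter (\<lambda>x. \<not> E v x) xs)"
    by (simp add: sum_length_filter_compl)
  then consider "k \<le> length (filter (E v) xs)" | "k \<le> length (filter (\<lambda>x. \<not> E v x) xs)"
    using len by linarith
  \<comment> \<open>\<open>ys\<close> is the tile through \<open>v\<close>, and \<open>zs\<close>
    are its \<open>k - 1\<close> other vertices, taken from \<open>xs\<close> on one side of
    \<open>v\<close>.\<close>
  then have "\<exists>ys zs. set ys = insert v (set zs) \<and> set zs \<subseteq> set xs \<and> distinct zs \<and> length zs = k - 1 \<and>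
      length ys = k \<and> distinct ys \<and> sorted_wrt E ys"
  proof cases
    case 1
    define zs where "zs = take (k - 1) (filter (E v) xs)"
    have zs: "set zs \<subseteq> {x \<in> set xs. E v x}" unfolding zs_def using set_take_subset by fastforce
    moreover have "length zs = k - 1" "distinct zs" "sorted_wrt E zs"
      using 1 insert.prems by (auto simp: zs_def sorted_wrt_take sorted_wrt_filter)
    ultimately show ?thesis using insert.prems \<open>0 < k\<close>
      by (intro exI[of _ "v # zs"] exI[of _ zs]) auto
  next
    case 2
    define zs where "zs = take (k - 1) (filter (\<lambda>x. \<not> E v x) xs)"
    have "set zs \<subseteq> {x \<in> set xs. \<not> E v x}" unfolding zs_def using set_take_subset by fastforce
    then have zs: "set zs \<subseteq> {x \<in> set xs. E x v}" using tot by auto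
    moreover have "length zs = k - 1" "distinct zs" "sorted_wrt E zs"
      using 2 insert.prems by (auto simp: zs_def sorted_wrt_take sorted_wrt_filter)
    ultimately show ?thesis using insert.prems \<open>0 < k\<close>
      by (intro exI[of _ "zs @ [v]"] exI[of _ zs]) (auto simp: sorted_wrt_append)
  qed
  then obtain ys zs where ys: "set ys = insert v (set zs)" "set zs \<subseteq> set xs" "distinct zs"
    "length zs = k - 1" "length ys = k" "distinct ys" "sorted_wrt E ys" by blast
  define xs' where "xs' = filter (\<lambda>x. x \<notin> set zs) xs"
  have set_xs': "set xs' = set xs - set zs" by (auto simp: xs'_def)
  have dxs': "distinct xs'" using insert.prems by (simp add: xs'_def)
  have "card (set xs') = card (set xs) - card (set zs)"
    unfolding set_xs' using ys(2) by (intro card_Diff_subset) auto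
  then have len': "length xs' = length xs - (k - 1)"
    using dxs' insert.prems(1) ys(3,4) by (simp add: distinct_card)
  have "tiling E k (R \<union> set xs')"
  proof (rule insert.IH[OF dxs'])
    show "sorted_wrt E xs'" using insert.prems by (simp add: xs'_def sorted_wrt_filter)
    show "R \<inter> set xs' = {}" using insert.prems set_xs' by auto
    show "total_in E (R \<union> set xs')"
      using insert.prems(4) set_xs' by (auto intro: total_in_subset)
    \<comment> \<open>Absorbing \<open>v\<close> costs only \<open>k - 1\<close> of the
      \<open>2 * k\<close> vertices of \<open>xs\<close> reserved for it.\<close>
    show "2 * k * card R \<le> length xs'" using len len' by linarith
    have "k dvd (Suc (card R) + length xs) - k"
      using insert.prems(6) insert.hyps by (intro dvd_diff_nat) auto
    moreover have "(Suc (card R) + length xs) - k = card R + length xs'"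
      using len len' \<open>0 < k\<close> by linarith
    ultimately show "k dvd card R + length xs'" by simp
  qed (use \<open>0 < k\<close> in simp)
  then have "tiling E k (set ys \<union> (R \<union> set xs'))"
    using ys set_xs' insert by (intro tiling.add) auto
  moreover have "set ys \<union> (R \<union> set xs') = insert v R \<union> set xs" using ys set_xs' by auto
  ultimately show ?case by simp
qed

text \<open>The bound yields a transitive tournament with \<open>2 * k\<close> vertices in reserve
  for each of the fewer than \<open>2 ^ k\<close> vertices that the greedy tiling leaves
  over.\<close>

lemma tiling_of_large:
  assumes "finite S" "total_in E S" "0 < k" "k dvd card S" "2 ^ (2 * k * 2 ^ k) \<le> card S"
  shows "tiling E k S"
proof -
  obtain xs where xs: "distinct xs" "length xs = 2 * k * 2 ^ k" "sorted_wrt E xs" "set xs \<subseteq> S"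
    using ex_transitive[OF assms(1,2,5)] by blast
  obtain R where R: "R \<subseteq> S - set xs" "card R < 2 ^ k" "tiling E k (S - set xs - R)"
    using greedy_tiling[of "S - set xs" E k] assms total_in_subset[of E S "S - set xs"] by auto
  have fin: "finite R" using R assms(1) finite_subset by blast
  \<comment> \<open>Since \<open>k\<close> divides the number of vertices tiled greedily, it also
    divides the number of those still to be tiled.\<close>
  have k_dvd: "k dvd card (S - set xs - R)"
    using R(3)
  proof (induction rule: tiling.induct)
    case (add S xs)
    have "finite S" using add.hyps(1) by (induction rule: tiling.induct) auto
    then show ?case using add by (simp add: card_Un_disjoint distinct_card)
  qed simp
  have "card S = card ((S - set xs - R) \<union> (R \<union> set xs))"
    using R xs by (intro arg_cong[of _ _ card]) auto
  also have "\<dots> = card (S - set xs - R) + card (R \<union> set xs)"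
    using assms(1) fin by (intro card_Un_disjoint) auto
  finally have "card S = card (S - set xs - R) + card (R \<union> set xs)" .
  moreover have "card (R \<union> set xs) = card R + length xs"
    using R xs fin by (subst card_Un_disjoint) (auto simp: distinct_card)
  ultimately have "k dvd card R + length xs" using k_dvd assms(4) by (metis dvd_add_right_iff)
  moreover have "2 * k * card R \<le> length xs" using R xs by simp
  moreover have "total_in E (R \<union> set xs)" using R xs assms(2) by (auto intro: total_in_subset)
  ultimately have "tiling E k (R \<union> set xs)" using fin xs R assms(3) by (intro tiling_absorb) auto
  then have "tiling E k ((S - set xs - R) \<union> (R \<union> set xs))"
    by (intro tiling_union[OF R(3)]) auto
  moreover have "(S - set xs - R) \<union> (R \<union> set xs) = S" using R xs by auto
  ultimately show ?thesis by simp
qed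

section \<open>Perfect packings\<close>

abbreviation arc_rel :: "'a pair_pre_digraph \<Rightarrow> 'a \<Rightarrow> 'a \<Rightarrow> bool" where
  "arc_rel G u v \<equiv> (u, v) \<in> parcs G"

lemma copy_in_of_list:
  assumes "pair_wf_digraph G" "distinct xs" "sorted_wrt (arc_rel G) xs" "set xs \<subseteq> pverts G"
  shows "\<exists>H. copy_in (transitive_tournament (length xs)) H G \<and> pverts H = set xs"
proof -
  let ?k = "length xs"
  define H where "H = \<lparr>pverts = set xs, parcs = {(xs ! i, xs ! j) |i j. i < j \<and> j < ?k}\<rparr>"
  \<comment> \<open>The arcs of \<open>H\<close> are again pairs, so tail and head stay the
    projections.\<close>
  define h :: "(nat, nat \<times> nat, 'a, 'a \<times> 'a) digraph_isomorphism" where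
    "h = \<lparr>iso_verts = (\<lambda>i. xs ! i), iso_arcs = (\<lambda>(i, j). (xs ! i, xs ! j)), iso_head = snd, iso_tail = fst\<rparr>"
  have wfH: "pair_wf_digraph H" by unfold_locales (auto simp: H_def)
  have "subgraph (with_proj H) (with_proj G)"
    using assms wfH by (auto simp: subgraph_def wf_digraph_wp_iff H_def sorted_wrt_iff_nth_less)
  moreover have "digraph_iso (with_proj (transitive_tournament ?k)) (with_proj H)"
    unfolding digraph_iso_def
  proof (intro exI conjI)
    have "pair_wf_digraph (transitive_tournament ?k)"
      by unfold_locales (auto simp: transitive_tournament_def)
    then show "pre_digraph.digraph_isomorphism (with_proj (transitive_tournament ?k)) h"
      using assms(2) unfolding pre_digraph.digraph_isomorphism_def
      by (auto simp: wf_digraph_wp_iff h_def inj_on_def transitive_tournament_def nth_eq_iff_index_eq)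
    have "{(xs ! i, xs ! j) |i j. i < j \<and> j < ?k} =
        (\<lambda>(i, j). (xs ! i, xs ! j)) ` {(i, j). i < j \<and> j < ?k}" by auto
    moreover have "set xs = (!) xs ` {..<?k}" by (auto simp: set_conv_nth)
    ultimately show "with_proj H = app_iso h (with_proj (transitive_tournament ?k))"
      by (simp add: app_iso_def h_def H_def transitive_tournament_def with_proj_def)
  qed
  ultimately have "copy_in (transitive_tournament ?k) H G" by (simp add: copy_in_def)
  then show ?thesis by (auto simp: H_def)
qed

lemma list_of_copy_in:
  assumes "copy_in (transitive_tournament k) H G"
  obtains xs where "distinct xs" "length xs = k" "sorted_wrt (arc_rel G) xs" "set xs = pverts H"
proof -
  let ?T = "with_proj (transitive_tournament k)"
  obtain h where h: "pre_digraph.digraph_isomorphism ?T h" "with_proj H = app_iso h ?T"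
    using assms by (auto simp: copy_in_def digraph_iso_def)
  \<comment> \<open>Equality with \<open>with_proj H\<close> forces the tail and head maps of
    \<open>h\<close> to be the projections; thus its arc map is determined by its vertex
    map.\<close>
  have eqs: "pverts H = iso_verts h ` {..<k}" "parcs H = iso_arcs h ` {(i, j). i < j \<and> j < k}"
    "fst = iso_tail h" "snd = iso_head h"
    using h(2) by (auto simp: with_proj_def app_iso_def transitive_tournament_def)
  have inj: "inj_on (iso_verts h) {..<k}"
    using h(1) by (simp add: pre_digraph.digraph_isomorphism_def transitive_tournament_def)
  have sub: "parcs H \<subseteq> parcs G" using assms by (auto simp: copy_in_def subgraph_def)
  have arcs: "arc_rel G (iso_verts h i) (iso_verts h j)" if "i < j" "j < k" for i j
  proof -
    have "iso_verts h i = fst (iso_arcs h (i, j))" "iso_verts h j = snd (iso_arcs h (i, j))"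
      using h(1) that unfolding eqs(3,4)
      by (auto simp: pre_digraph.digraph_isomorphism_def transitive_tournament_def)
    moreover have "iso_arcs h (i, j) \<in> parcs H" using that unfolding eqs(2) by blast
    ultimately show ?thesis using sub by auto
  qed
  show ?thesis
  proof
    show "distinct (map (iso_verts h) [0..<k])"
      using inj by (simp add: distinct_map atLeast0LessThan)
    show "sorted_wrt (arc_rel G) (map (iso_verts h) [0..<k])"
      using arcs by (simp add: sorted_wrt_iff_nth_less)
    show "set (map (iso_verts h) [0..<k]) = pverts H" using eqs(1) by (simp add: atLeast0LessThan)
  qed simp
qed

lemma perfect_packing_of_tiling:
  assumes "tiling (arc_rel G) k (pverts G)" "pair_wf_digraph G"
  shows "\<exists>P. perfect_packing (transitive_tournament k) G P"
proof -
  have "\<exists>P. (\<forall>H\<in>P. copy_in (transitive_tournament k) H G) \<and>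
      (\<forall>H\<in>P. \<forall>H'\<in>P. H \<noteq> H' \<longrightarrow> pverts H \<inter> pverts H' = {}) \<and> (\<Union>H\<in>P. pverts H) = S"
    if "tiling (arc_rel G) k S" "S \<subseteq> pverts G" for S
    using that
  proof (induction rule: tiling.induct)
    case empty
    then show ?case by (intro exI[of _ "{}"]) auto
  next
    case (add S xs)
    obtain P where P: "\<forall>H\<in>P. copy_in (transitive_tournament k) H G"
      "\<forall>H\<in>P. \<forall>H'\<in>P. H \<noteq> H' \<longrightarrow> pverts H \<inter> pverts H' = {}" "(\<Union>H\<in>P. pverts H) = S"
      using add by auto
    obtain H where H: "copy_in (transitive_tournament k) H G" "pverts H = set xs"
      using copy_in_of_list[OF assms(2) add.hyps(2,4)] add by auto
    have "pverts H \<inter> pverts H' = {}" "pverts H' \<inter> pverts H = {}" if "H' \<in> P" for H'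
      using that P(3) H(2) add.hyps(5) by blast+
    then show ?case using P H by (intro exI[of _ "insert H P"]) auto
  qed
  then show ?thesis using assms(1) unfolding perfect_packing_def by blast
qed

lemma tiling_of_perfect_packing:
  assumes "perfect_packing (transitive_tournament k) G P" "finite (pverts G)" "0 < k"
  shows "tiling (arc_rel G) k (pverts G)"
proof -
  have U: "(\<Union>H\<in>P. pverts H) = pverts G"
    and disj: "\<And>H H'. \<lbrakk>H \<in> P; H' \<in> P; H \<noteq> H'\<rbrakk> \<Longrightarrow> pverts H \<inter> pverts H' = {}"
    using assms(1) by (auto simp: perfect_packing_def)
  have H: "tiling (arc_rel G) k (pverts H) \<and> pverts H \<noteq> {}" if "H \<in> P" for H
  proof -
    have copy: "copy_in (transitive_tournament k) H G"
      using assms(1) that by (simp add: perfect_packing_def)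
    obtain xs where xs: "distinct xs" "length xs = k" "sorted_wrt (arc_rel G) xs" "set xs = pverts H"
      by (rule list_of_copy_in[OF copy]) (rule that; assumption)
    then show ?thesis using tiling_set[of xs "arc_rel G" k] assms(3) by auto
  qed
  \<comment> \<open>Disjoint copies have different vertex sets because \<open>0 < k\<close> makes
    these nonempty. Hence \<open>P\<close> is finite, as \<open>tiling_UN\<close> requires.\<close>
  have "inj_on pverts P" using H disj by (intro inj_onI) (metis inf.idem)
  moreover have "pverts ` P \<subseteq> Pow (pverts G)" using U by blast
  ultimately have "finite P" using assms(2) by (metis finite_Pow_iff finite_imageD finite_subset)
  then show ?thesis using tiling_UN[of P "arc_rel G" k pverts] H disj U by auto
qed

text \<open>The order \<open>k * 2 ^ (2 * k * 2 ^ k)\<close> is good by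
  \<open>tiling_of_large\<close>, so the \<open>LEAST\<close> in the definition is attained.\<close>

lemma oriented_tiling_Ramsey_props:
  assumes "0 < k"
  shows "0 < oriented_tiling_Ramsey k" "k dvd oriented_tiling_Ramsey k"
    "\<And>T :: nat pair_pre_digraph. \<lbrakk>tournament T; card (pverts T) = oriented_tiling_Ramsey k\<rbrakk>
      \<Longrightarrow> \<exists>P. perfect_packing (transitive_tournament k) T P"
proof -
  let ?good = "\<lambda>m. 0 < m \<and> k dvd m \<and> (\<forall>T :: nat pair_pre_digraph. tournament T \<and> card (pverts T) = m \<longrightarrow>
    (\<exists>P. perfect_packing (transitive_tournament k) T P))"
  let ?m = "k * 2 ^ (2 * k * 2 ^ k)"
  have "?good ?m"
  proof (intro conjI allI impI)
    fix T :: "nat pair_pre_digraph" assume T: "tournament T \<and> card (pverts T) = ?m"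
    interpret tournament T using T by simp
    have "total_in (arc_rel T) (pverts T)" using complete by (auto simp: total_in_def)
    then have "tiling (arc_rel T) k (pverts T)"
      using T assms by (intro tiling_of_large) auto
    then show "\<exists>P. perfect_packing (transitive_tournament k) T P"
      by (rule perfect_packing_of_tiling) unfold_locales
  qed (use assms in auto)
  then have "?good (oriented_tiling_Ramsey k)"
    unfolding oriented_tiling_Ramsey_def by (rule LeastI[of ?good])
  then show "0 < oriented_tiling_Ramsey k" "k dvd oriented_tiling_Ramsey k"
    "\<And>T :: nat pair_pre_digraph. \<lbrakk>tournament T; card (pverts T) = oriented_tiling_Ramsey k\<rbrakk>
      \<Longrightarrow> \<exists>P. perfect_packing (transitive_tournament k) T P" by blast+
qed

text \<open>The Ramsey number is defined through tournaments on natural numbers: number the vertices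
  of \<open>S\<close>, pack there, and carry the tiling back.\<close>

lemma tiling_of_order_Ramsey:
  assumes "0 < k" "finite S" "card S = oriented_tiling_Ramsey k" "total_in E S"
    and "\<And>x y. E x y \<Longrightarrow> \<not> E y x"
  shows "tiling E k S"
proof -
  let ?m = "oriented_tiling_Ramsey k"
  obtain g where g: "bij_betw g {0..<?m} S" using ex_bij_betw_nat_finite[OF assms(2)] assms(3) by metis
  have irrefl: "\<not> E x x" for x using assms(5) by blast
  define T where "T = \<lparr>pverts = {0..<?m}, parcs = {(i, j). i < ?m \<and> j < ?m \<and> E (g i) (g j)}\<rparr>"
  have "tournament T"
  proof
    have "parcs T \<subseteq> pverts T \<times> pverts T" by (auto simp: T_def)
    then show "finite (parcs T)" by (rule finite_subset) (simp add: T_def)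
    show "arc_rel T u v \<or> arc_rel T v u" if "u \<in> pverts T" "v \<in> pverts T" "u \<noteq> v" for u v
    proof -
      have "g u \<in> S" "g v \<in> S" "g u \<noteq> g v"
        using that g by (auto simp: T_def bij_betw_def inj_on_def)
      then show ?thesis using that assms(4) by (auto simp: T_def total_in_def)
    qed
  qed (use assms(5) irrefl in \<open>auto simp: T_def\<close>)
  then obtain P where "perfect_packing (transitive_tournament k) T P"
    using oriented_tiling_Ramsey_props(3)[OF assms(1), of T] by (auto simp: T_def)
  then have "tiling (arc_rel T) k (pverts T)"
    by (rule tiling_of_perfect_packing) (use assms(1) in \<open>simp_all add: T_def\<close>)
  then have "tiling E k (g ` pverts T)"
    by (rule tiling_image) (use g in \<open>auto simp: T_def bij_betw_def\<close>)
  then show ?thesis using g by (simp add: T_def bij_betw_def)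
qed

section \<open>Passing to the complement, and the degree condition\<close>

definition non_adj :: "('a \<Rightarrow> 'a \<Rightarrow> bool) \<Rightarrow> 'a \<Rightarrow> 'a \<Rightarrow> bool" where
  "non_adj E x y \<longleftrightarrow> x \<noteq> y \<and> \<not> E x y \<and> \<not> E y x"

text \<open>The Hajnal-Szemeredi theorem for the complement, whose independent sets are the
  cliques.\<close>

lemma clique_partition:
  assumes "finite S" "card S = m * q" "\<And>x. x \<in> S \<Longrightarrow> card (nbrs (non_adj E) S x) < q"
  obtains F where "(\<Union>c\<in>{..<q}. F c) = S" "\<And>c. c < q \<Longrightarrow> card (F c) = m \<and> total_in E (F c)"
    "\<And>c d :: nat. c \<noteq> d \<Longrightarrow> F c \<inter> F d = {}"
proof -
  have "bounded_degree S (non_adj E) {..<q}"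
    using assms by unfold_locales (auto simp: non_adj_def symp_def irreflp_def)
  then obtain f where f: "equitable S (non_adj E) {..<q} m f"
    using hajnal_szemeredi[of S "non_adj E" "{..<q}" m] assms(2) by auto
  show ?thesis
  proof
    show "(\<Union>c\<in>{..<q}. colour_class S f c) = S"
      using f by (auto simp: equitable_def proper_def colour_class_def)
    show "card (colour_class S f c) = m \<and> total_in E (colour_class S f c)" if "c < q" for c
      using f that by (auto simp: equitable_def proper_def colour_class_def total_in_def non_adj_def)
    show "colour_class S f c \<inter> colour_class S f d = {}" if "c \<noteq> d" for c d
      using that by (auto simp: colour_class_def)
  qed
qed

text \<open>\<open>j\<close> is the number of tiles to remove before a multiple of the Ramsey number
  is reached. The bound on non-neighbours passes to subsets, so it survives each removal with the
  same \<open>q\<close>.\<close>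

lemma tiling_of_small_non_adj:
  assumes "0 < k" "finite S" "card S = oriented_tiling_Ramsey k * q + j * k"
    and "\<And>x y. E x y \<Longrightarrow> \<not> E y x" "\<And>x. x \<in> S \<Longrightarrow> card (nbrs (non_adj E) S x) < q"
  shows "tiling E k S"
  using assms(2,3,5)
proof (induction j arbitrary: S)
  case 0
  let ?m = "oriented_tiling_Ramsey k"
  have card: "card S = ?m * q" using 0 by simp
  obtain F where F: "(\<Union>c\<in>{..<q}. F c) = S" "\<And>c. c < q \<Longrightarrow> card (F c) = ?m \<and> total_in E (F c)"
    "\<And>c d :: nat. c \<noteq> d \<Longrightarrow> F c \<inter> F d = {}"
    by (rule clique_partition[OF 0(1) card 0(3)]) (assumption, (rule that; assumption))
  have "tiling E k (F c)" if "c < q" for c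
    using F that 0(1) assms(1,4) by (intro tiling_of_order_Ramsey) (auto intro: finite_subset[of _ S])
  then show ?case using tiling_UN[of "{..<q}" E k F] F by auto
next
  case (Suc j)
  let ?m = "oriented_tiling_Ramsey k"
  obtain S' where S': "S' \<subseteq> S" "card S' = ?m * q"
    using obtain_subset_with_card_n[of "?m * q" S] Suc.prems(2) by (metis le_add1)
  have mono: "card (nbrs (non_adj E) U x) < q" if "U \<subseteq> S" "x \<in> U" for U x
  proof -
    have "card (nbrs (non_adj E) U x) \<le> card (nbrs (non_adj E) S x)"
      using that Suc.prems(1) by (intro card_mono) (auto simp: nbrs_def)
    then show ?thesis using Suc.prems(3)[of x] that by auto
  qed
  have finS': "finite S'" using S' Suc.prems(1) finite_subset by blast
  obtain F where F: "(\<Union>c\<in>{..<q}. F c) = S'" "\<And>c. c < q \<Longrightarrow> card (F c) = ?m \<and> total_in E (F c)"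
    by (rule clique_partition[OF finS' S'(2) mono[OF S'(1)]]) (assumption, (rule that; assumption))
  have "0 < card S" using Suc.prems(2) assms(1) by simp
  then obtain x where "x \<in> S" by (metis card_gt_0_iff ex_in_conv)
  then have q: "0 < q" using Suc.prems(3)[of x] by simp
  have F0: "F 0 \<subseteq> S" "card (F 0) = ?m" using F q S' by auto
  have "tiling E k (F 0)"
    using F(2)[OF q] F0 Suc.prems(1) assms(1,4) by (intro tiling_of_order_Ramsey) (auto intro: finite_subset)
  \<comment> \<open>The clique \<open>F 0\<close> is nonempty, so its tiling contains at least one
    tile.\<close>
  then obtain xs where xs: "distinct xs" "length xs = k" "sorted_wrt E xs" "set xs \<subseteq> F 0"
  proof cases
    case empty
    then show ?thesis using F0 oriented_tiling_Ramsey_props(1)[OF assms(1)] by simp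
  qed (use that in blast)
  have sub: "set xs \<subseteq> S" using xs F0 by blast
  have "tiling E k (S - set xs)"
  proof (rule Suc.IH)
    have "card (S - set xs) = card S - k"
      using sub xs by (simp add: card_Diff_subset distinct_card)
    then show "card (S - set xs) = ?m * q + j * k" using Suc.prems(2) by simp
  qed (use Suc.prems mono in auto)
  then have "tiling E k (set xs \<union> (S - set xs))" using xs by (intro tiling.add) auto
  moreover have "set xs \<union> (S - set xs) = S" using sub by auto
  ultimately show ?case by simp
qed

text \<open>The vertex \<open>v\<close>, its non-neighbours, its in-neighbours and its
  out-neighbours are disjoint; for the last two sets this holds as opposite arcs are
  excluded.\<close>

lemma (in oriented_graph) card_non_adj:
  assumes v: "v \<in> pverts G"
  shows "card (nbrs (non_adj (arc_rel G)) (pverts G) v) + 1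
    + (in_degree (with_proj G) v + out_degree (with_proj G) v) \<le> card (pverts G)"
proof -
  define I where "I = {u \<in> pverts G. arc_rel G u v}"
  define O' where "O' = {u \<in> pverts G. arc_rel G v u}"
  let ?N = "nbrs (non_adj (arc_rel G)) (pverts G) v"
  have fin: "finite I" "finite O'" "finite ?N" using pair_finite_verts by (auto simp: I_def O'_def)
  have "in_arcs (with_proj G) v = (\<lambda>u. (u, v)) ` I"
    by (auto simp: in_arcs_def I_def dest: in_arcsD1)
  then have i: "in_degree (with_proj G) v = card I"
    by (simp add: in_degree_def card_image inj_on_def)
  have "out_arcs (with_proj G) v = (\<lambda>u. (v, u)) ` O'"
    by (auto simp: out_arcs_def O'_def dest: in_arcsD2)
  then have o: "out_degree (with_proj G) v = card O'"
    by (simp add: out_degree_def card_image inj_on_def)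
  have v_notin: "v \<notin> I" "v \<notin> O'" "v \<notin> ?N"
    using pair_no_loops[of "(v, v)"] by (auto simp: I_def O'_def nbrs_def non_adj_def)
  have disj: "?N \<inter> (I \<union> O') = {}" "I \<inter> O' = {}"
    using no_opposite_arcs by (auto simp: I_def O'_def nbrs_def non_adj_def)
  have "card (insert v (?N \<union> (I \<union> O'))) = Suc (card ?N + (card I + card O'))"
    using fin disj v_notin by (simp add: card_Un_disjoint)
  moreover have "insert v (?N \<union> (I \<union> O')) \<subseteq> pverts G"
    using v by (auto simp: nbrs_def I_def O'_def)
  ultimately have "Suc (card ?N + (card I + card O')) \<le> card (pverts G)"
    using pair_finite_verts by (metis card_mono)
  then show ?thesis using i o by simp
qed

theorem proposition9:
  fixes G :: "'a pair_pre_digraph" and k :: nat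
  assumes "k \<ge> 1"
    and "oriented_graph G"
    and "k dvd card (pverts G)"
    and "real (min_degree G) \<ge>
           (1 - 1 / real (oriented_tiling_Ramsey k)) * real (card (pverts G))"
  shows "\<exists>P. perfect_packing (transitive_tournament k) G P"
proof -
  interpret oriented_graph G by fact
  have k: "0 < k" using assms(1) by simp
  define m where "m = oriented_tiling_Ramsey k"
  define n where "n = card (pverts G)"
  have m: "0 < m" "k dvd m" using oriented_tiling_Ramsey_props[OF k] by (auto simp: m_def)
  have non_adj: "card (nbrs (non_adj (arc_rel G)) (pverts G) v) < n div m" if v: "v \<in> pverts G" for v
  proof -
    define d where "d = in_degree (with_proj G) v + out_degree (with_proj G) v"
    define c where "c = card (nbrs (non_adj (arc_rel G)) (pverts G) v)"
    \<comment> \<open>The minimum includes \<open>v\<close>, so the unspecified value for the graph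
      without vertices does not arise.\<close>
    have "min_degree G \<le> d"
      unfolding min_degree_def d_def using pair_finite_verts v by (intro Min_le) auto
    then have "(1 - 1 / real m) * real n \<le> real d" using assms(4) by (simp add: m_def n_def)
    moreover have "real (c + 1) + real d \<le> real n"
      using card_non_adj[OF v] unfolding c_def d_def n_def by linarith
    \<comment> \<open>The \<open>+ 1\<close> accounts for \<open>v\<close> itself and gives the
      strict bound by \<open>n div m\<close>; rounding down costs nothing since \<open>c + 1\<close>
      is an integer.\<close>
    ultimately have "real (c + 1) \<le> real n / real m" by (simp add: algebra_simps)
    then have "real ((c + 1) * m) \<le> real n" using m(1) by (simp add: field_simps)
    then have "(c + 1) * m \<le> n" by (simp only: of_nat_le_iff)
    then have "c + 1 \<le> n div m" using m(1) by (simp add: less_eq_div_iff_mult_less_eq)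
    then show ?thesis by (simp add: c_def)
  qed
  \<comment> \<open>The remainder can therefore be removed in tiles of \<open>k\<close>
    vertices.\<close>
  have "k dvd n mod m" using m(2) assms(3) by (simp add: n_def dvd_mod)
  then obtain j where "n mod m = j * k" by (metis dvd_div_mult_self)
  then have "card (pverts G) = m * (n div m) + j * k" by (metis n_def mult_div_mod_eq)
  then have "tiling (arc_rel G) k (pverts G)"
    using k pair_finite_verts no_opposite_arcs non_adj unfolding m_def
    by (intro tiling_of_small_non_adj[where q = "n div m" and j = j]) (auto simp: m_def)
  then show ?thesis by (rule perfect_packing_of_tiling) unfold_locales
qed

end
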